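(* Let $\Omega\subset\mathbb{R}^N$ be a bounded open connected set and $h\in C(\Omega)$ with $h(\Omega)\subset\mathcal{I}_k:=\big((N-2k)\frac{\pi}{2},(N-2(k-1))\frac{\pi}{2}\big)$ for some fixed $k\in\{1,\dots,N\}$. Let $G(A):=\sum_{i=1}^N\arctan(\lambda_i(A))$ and $\Theta(x):=\{(r,A)\in\mathbb{R}\times\mathcal{S}(N):G(A)\ge h(x)\}$. Then $\Theta$ is a Hausdorff continuous proper elliptic map and $\partial\Theta(x)\subset\{(r,A):G(A)=h(x)\}$ for every $x\in\Omega$. Moreover, if $u\in\mathrm{USC}(\overline\Omega)$ restricts to a viscosity subsolution and $v\in\mathrm{LSC}(\overline\Omega)$ restricts to a viscosity supersolution of $G(D^2u(x))=h(x)$ in $\Omega$, then $u\le v$ on $\partial\Omega$ implies $u\le v$ in $\Omega$.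
   Context: $\mathcal{S}(N)$: real symmetric $N\times N$ matrices with usual partial order; $\lambda_1(A)\le\dots\le\lambda_N(A)$ eigenvalues. $\mathcal{Q}:=\{(s,P): s\le0,\ P\ge0\}$. A proper elliptic map assigns to each $x\in\Omega$ a closed, nonempty set $\subsetneq\mathbb{R}\times\mathcal{S}(N)$ invariant under adding elements of $\mathcal Q$. Hausdorff continuity: with norm $\|(r,A)\|=\max\{|r|,\max_i|\lambda_i(A)|\}$ and the induced Hausdorff distance $d_{\mathcal H}$ (possibly $+\infty$), for all $x\in\Omega,\eta>0$ there is $\delta>0$ with $d_{\mathcal H}(\Theta(x),\Theta(y))<\eta$ for $y\in\Omega$, $|x-y|<\delta$. $J^+_{x_0}u:=\{(\varphi(x_0),D^2\varphi(x_0)):\varphi$ is $C^2$ near $x_0$, $u\le\varphi$ near $x_0$, $u(x_0)=\varphi(x_0)\}$, $J^-_{x_0}u$ likewise with $u\ge\varphi$. $u\in\mathrm{USC}(\Omega)$ is a viscosity subsolution if $G(A)\ge h(x_0)$ for all $x_0\in\Omega$, $(r,A)\in J^+_{x_0}u$; $v\in\mathrm{LSC}(\Omega)$ is a viscosity supersolution if $G(A)\le h(x_0)$ for all $x_0\in\Omega$, $(r,A)\in J^-_{x_0}v$. *)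

theory Defs
  imports "HOL-Analysis.Analysis" "HOL-Computational_Algebra.Polynomial" "HOL-Library.Multiset"
begin

definition SymM :: "(real^'n^'n) set" where
  "SymM = {A. transpose A = A}"

definition psd_le :: "real^'n^'n \<Rightarrow> real^'n^'n \<Rightarrow> bool" where
  "psd_le A B \<longleftrightarrow> (\<forall>x::real^'n. 0 \<le> x \<bullet> ((B - A) *v x))"

definition charpoly :: "real^'n^'n \<Rightarrow> real poly" where
  "charpoly A = det (\<chi> i j. (if i = j then [:0, 1:] else 0) - [:A $ i $ j:])"

definition eigs :: "real^'n^'n \<Rightarrow> real list" where
  "eigs A = sorted_list_of_multiset (proots (charpoly A))"

definition lam :: "real^'n^'n \<Rightarrow> nat \<Rightarrow> real" where
  "lam A i = eigs A ! (i - 1)"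

definition Gop :: "real^'n^'n \<Rightarrow> real" where
  "Gop A = (\<Sum>i=1..CARD('n). arctan (lam A i))"

definition Qset :: "(real \<times> (real^'n^'n)) set" where
  "Qset = {(s, P). s \<le> 0 \<and> P \<in> SymM \<and> psd_le 0 P}"

definition proper_elliptic :: "(real^'n) set \<Rightarrow> (real^'n \<Rightarrow> (real \<times> (real^'n^'n)) set) \<Rightarrow> bool" where
  "proper_elliptic \<Omega> \<Theta> \<longleftrightarrow>
     (\<forall>x\<in>\<Omega>. \<Theta> x \<subseteq> UNIV \<times> SymM \<and> closed (\<Theta> x) \<and> \<Theta> x \<noteq> {} \<and> \<Theta> x \<noteq> UNIV \<times> SymM \<and>
        (\<forall>r A s P. (r, A) \<in> \<Theta> x \<longrightarrow> (s, P) \<in> Qset \<longrightarrow> (r + s, A + P) \<in> \<Theta> x))"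

definition pnorm :: "real \<times> (real^'n^'n) \<Rightarrow> real" where
  "pnorm p = max \<bar>fst p\<bar> (Max {\<bar>lam (snd p) i\<bar> | i. i \<in> {1..CARD('n)}})"

definition hdist :: "(real \<times> (real^'n^'n)) set \<Rightarrow> (real \<times> (real^'n^'n)) set \<Rightarrow> ereal" where
  "hdist S T = max (SUP a\<in>S. INF b\<in>T. ereal (pnorm (a - b)))
                   (SUP b\<in>T. INF a\<in>S. ereal (pnorm (a - b)))"

definition hausdorff_continuous :: "(real^'n) set \<Rightarrow> (real^'n \<Rightarrow> (real \<times> (real^'n^'n)) set) \<Rightarrow> bool" where
  "hausdorff_continuous \<Omega> \<Theta> \<longleftrightarrow>
     (\<forall>x\<in>\<Omega>. \<forall>\<eta>>0. \<exists>\<delta>>0. \<forall>y\<in>\<Omega>. dist x y < \<delta> \<longrightarrow> hdist (\<Theta> x) (\<Theta> y) < ereal \<eta>)"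

definition C2_hess :: "(real^'n \<Rightarrow> real) \<Rightarrow> real^'n \<Rightarrow> real^'n^'n \<Rightarrow> bool" where
  "C2_hess \<phi> x0 H \<longleftrightarrow>
     (\<exists>e>0. \<exists>g Hf. (\<forall>x\<in>ball x0 e. (\<phi> has_derivative (\<lambda>v. g x \<bullet> v)) (at x) \<and>
                                    (g has_derivative (\<lambda>v. Hf x *v v)) (at x))
                 \<and> continuous_on (ball x0 e) Hf \<and> H = Hf x0)"

definition Jplus :: "(real^'n) set \<Rightarrow> (real^'n \<Rightarrow> real) \<Rightarrow> real^'n \<Rightarrow> (real \<times> (real^'n^'n)) set" where
  "Jplus \<Omega> u x0 = {(\<phi> x0, H) | \<phi> H. C2_hess \<phi> x0 H \<and>
       (\<exists>e>0. \<forall>x\<in>ball x0 e \<inter> \<Omega>. u x \<le> \<phi> x) \<and> u x0 = \<phi> x0}"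

definition Jminus :: "(real^'n) set \<Rightarrow> (real^'n \<Rightarrow> real) \<Rightarrow> real^'n \<Rightarrow> (real \<times> (real^'n^'n)) set" where
  "Jminus \<Omega> u x0 = {(\<phi> x0, H) | \<phi> H. C2_hess \<phi> x0 H \<and>
       (\<exists>e>0. \<forall>x\<in>ball x0 e \<inter> \<Omega>. u x \<ge> \<phi> x) \<and> u x0 = \<phi> x0}"

definition usc_on :: "(real^'n) set \<Rightarrow> (real^'n \<Rightarrow> real) \<Rightarrow> bool" where
  "usc_on S u \<longleftrightarrow> (\<forall>x\<in>S. \<forall>a. u x < a \<longrightarrow> (\<exists>e>0. \<forall>y\<in>S. dist y x < e \<longrightarrow> u y < a))"

definition lsc_on :: "(real^'n) set \<Rightarrow> (real^'n \<Rightarrow> real) \<Rightarrow> bool" where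
  "lsc_on S u \<longleftrightarrow> (\<forall>x\<in>S. \<forall>a. a < u x \<longrightarrow> (\<exists>e>0. \<forall>y\<in>S. dist y x < e \<longrightarrow> a < u y))"

definition visc_sub :: "(real^'n) set \<Rightarrow> (real^'n \<Rightarrow> real) \<Rightarrow> (real^'n \<Rightarrow> real) \<Rightarrow> bool" where
  "visc_sub \<Omega> h u \<longleftrightarrow> usc_on \<Omega> u \<and>
     (\<forall>x0\<in>\<Omega>. \<forall>r A. (r, A) \<in> Jplus \<Omega> u x0 \<longrightarrow> Gop A \<ge> h x0)"

definition visc_super :: "(real^'n) set \<Rightarrow> (real^'n \<Rightarrow> real) \<Rightarrow> (real^'n \<Rightarrow> real) \<Rightarrow> bool" where
  "visc_super \<Omega> h v \<longleftrightarrow> lsc_on \<Omega> v \<and>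
     (\<forall>x0\<in>\<Omega>. \<forall>r A. (r, A) \<in> Jminus \<Omega> v x0 \<longrightarrow> Gop A \<le> h x0)"

end

theory Submission
  imports Defs
begin

text \<open>
  The comparison principle is proved without Alexandrov's theorem or any measure theory.
  Let \<open>f\<close> be semiconvex with a local maximum at a point \<open>z\<close>. Among all pairs of a quadratic
  function touching \<open>f\<close> from above near \<open>z\<close>, with Hessian \<open>L\<close>, and an upper bound
  \<open>\<mu>\<close> of the spectrum of \<open>L\<close>, choose one that nearly minimises
  \<open>\<mu> + \<theta> tr L\<close>. Since \<open>L\<close> is bounded below by semiconvexity and \<open>L = 0\<close>, \<open>\<mu> = 0\<close> is
  admissible at \<open>z\<close>, a small \<open>\<theta>\<close> forces \<open>L\<close> to be almost nonpositive. Minimality makes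
  \<open>f\<close> minus the quadratic function a viscosity subsolution, up to a small error, of a uniformly
  elliptic equation; it is nonpositive and vanishes at the contact point, so the quantitative strong
  maximum principle (a Hopf barrier on every small scale) bounds it from below by
  \<open>- \<eta> |w|\<^sup>2\<close>. Hence \<open>f\<close> is twice differentiable there up to \<open>\<eta>\<close>, which suffices for the
  theorem on sums for \<open>u(x) - v(y) - c |x - y|\<^sup>2 / 2\<close> after sup-convolution.

  The equation is made strict by adding \<open>\<tau> |x|\<^sup>2 / 2\<close> to \<open>u\<close>: as long as the phase \<open>G(A)\<close>
  stays away from the special values \<open>(N - 2j) \<pi> / 2\<close>, replacing \<open>A\<close> by \<open>A + \<tau> I\<close>
  raises it by a definite amount. The same gain gives Hausdorff continuity of \<open>\<Theta>\<close>.
\<close>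

section \<open>Eigenvalues of symmetric matrices\<close>

text \<open>For small \<open>t\<close> of sign opposite to \<open>b\<close> the linear term
  dominates the quadratic one. This is the first-order condition at the maximiser of a Rayleigh
  quotient.\<close>

lemma nonneg_quadratic_imp_linear_coeff_zero:
  fixes a b :: real
  assumes "\<And>t. 0 \<le> t * b + t\<^sup>2 * a"
  shows "b = 0"
proof (rule ccontr)
  assume b: "b \<noteq> 0"
  define t where "t = - b / (\<bar>a\<bar> + 1)"
  have "t * b + t\<^sup>2 * a = b\<^sup>2 / (\<bar>a\<bar> + 1) * (a / (\<bar>a\<bar> + 1) - 1)"
    by (simp add: t_def power2_eq_square divide_simps) (simp add: algebra_simps)
  moreover have "a / (\<bar>a\<bar> + 1) < 1" by (rule divide_less_eq_1_pos[THEN iffD2]) linarith+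
  then have "a / (\<bar>a\<bar> + 1) - 1 < 0" by simp
  moreover have "b\<^sup>2 / (\<bar>a\<bar> + 1) > 0" using b by simp
  ultimately have "t * b + t\<^sup>2 * a < 0" by (metis mult_pos_neg)
  then show False using assms[of t] by simp
qed

text \<open>The Rayleigh quotient attains its maximum on the compact unit sphere of
  \<open>S\<close>, and a maximiser is an eigenvector.\<close>

lemma selfadjoint_eigenvector_exists:
  fixes L :: "'a::euclidean_space \<Rightarrow> 'a"
  assumes L: "linear L" and sa: "\<And>x y. L x \<bullet> y = x \<bullet> L y"
    and S: "subspace S" and inv: "\<And>x. x \<in> S \<Longrightarrow> L x \<in> S" and ne: "S \<noteq> {0}"
  obtains x c where "x \<in> S" "norm x = 1" "L x = c *\<^sub>R x"
proof -
  let ?K = "S \<inter> sphere 0 1"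
  have "compact ?K" by (intro closed_Int_compact closed_subspace S compact_sphere)
  moreover obtain z where z: "z \<in> S" "z \<noteq> 0" using ne subspace_0[OF S] by blast
  then have "(1 / norm z) *\<^sub>R z \<in> ?K" using S by (simp add: subspace_scale)
  moreover have "continuous_on ?K (\<lambda>x. x \<bullet> L x)"
    by (intro continuous_intros linear_continuous_on linear_conv_bounded_linear[THEN iffD1] L)
  ultimately obtain x where x: "x \<in> ?K" and mx: "\<And>y. y \<in> ?K \<Longrightarrow> y \<bullet> L y \<le> x \<bullet> L x"
    using continuous_attains_sup[of ?K "\<lambda>x. x \<bullet> L x"] by blast
  define c where "c = x \<bullet> L x"
  have nx: "norm x = 1" "x \<in> S" using x by auto
  have le: "y \<bullet> L y \<le> c * (y \<bullet> y)" if y: "y \<in> S" for y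
  proof (cases "y = 0")
    case False
    have "(1 / norm y) *\<^sub>R y \<in> ?K" using S y False by (simp add: subspace_scale)
    from mx[OF this] have "(y \<bullet> L y) / (norm y)\<^sup>2 \<le> c"
      using L by (simp add: linear_scale c_def power2_eq_square)
    then show ?thesis using False by (simp add: pos_divide_le_eq power2_norm_eq_inner)
  qed simp
  \<comment> \<open>The form \<open>c * (y \<bullet> y) - y \<bullet> L y\<close> is nonnegative on
    \<open>S\<close> and vanishes at \<open>x\<close>; \<open>h\<close> is half its gradient there.
    Moving from \<open>x\<close> along \<open>h\<close>, which stays in \<open>S\<close> by
    invariance, forces \<open>h \<bullet> h = 0\<close>.\<close>
  define h where "h = c *\<^sub>R x - L x"
  have hS: "h \<in> S" using nx inv S by (simp add: h_def subspace_diff subspace_scale)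
  have "0 \<le> t * (2 * (h \<bullet> h)) + t\<^sup>2 * (c * (h \<bullet> h) - h \<bullet> L h)" for t
  proof -
    have "x + t *\<^sub>R h \<in> S" using nx hS S by (simp add: subspace_add subspace_scale)
    from le[OF this] have "0 \<le> c * ((x + t *\<^sub>R h) \<bullet> (x + t *\<^sub>R h)) - (x + t *\<^sub>R h) \<bullet> L (x + t *\<^sub>R h)"
      by simp
    also have "\<dots> = c * (x \<bullet> x) - x \<bullet> L x + t * (2 * ((c *\<^sub>R x - L x) \<bullet> h)) + t\<^sup>2 * (c * (h \<bullet> h) - h \<bullet> L h)"
      using L sa[of x h] sa[of h x] by (simp add: linear_add linear_scale inner_simps inner_commute power2_eq_square algebra_simps)
    also have "x \<bullet> x = 1" using nx by (simp add: norm_eq_1)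
    finally show ?thesis by (simp add: c_def h_def)
  qed
  then have "h = 0" using nonneg_quadratic_imp_linear_coeff_zero[of "2 * (h \<bullet> h)"] by auto
  then show ?thesis using that[of x c] nx by (simp add: h_def)
qed

text \<open>Induction on the dimension: one unit eigenvector \<open>x\<close> is split off, and
  self-adjointness makes its orthogonal complement in \<open>S\<close> invariant again.\<close>

lemma selfadjoint_orthonormal_eigenbasis_subspace:
  fixes L :: "'a::euclidean_space \<Rightarrow> 'a"
  assumes L: "linear L" and sa: "\<And>x y. L x \<bullet> y = x \<bullet> L y"
  shows "\<lbrakk>subspace S; \<And>x. x \<in> S \<Longrightarrow> L x \<in> S\<rbrakk> \<Longrightarrow>
    \<exists>B. finite B \<and> pairwise orthogonal B \<and> (\<forall>x\<in>B. norm x = 1 \<and> (\<exists>c. L x = c *\<^sub>R x)) \<and> span B = S"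
proof (induction "dim S" arbitrary: S rule: less_induct)
  case less
  show ?case
  proof (cases "S = {0}")
    case True
    then show ?thesis by (intro exI[of _ "{}"]) auto
  next
    case False
    obtain x c where x: "x \<in> S" "norm x = 1" "L x = c *\<^sub>R x"
      using selfadjoint_eigenvector_exists[OF L sa less.prems False] by blast
    define S' where "S' = {y \<in> S. x \<bullet> y = 0}"
    have xx: "x \<bullet> x = 1" using x by (simp add: norm_eq_1)
    have S': "subspace S'"
      using less.prems(1) by (auto simp: S'_def subspace_def inner_simps)
    have "S' \<subset> S" using x xx unfolding S'_def by force
    then have "dim S' < dim S"
      using S' less.prems(1) by (intro dim_psubset) (simp add: span_eq_iff[THEN iffD2])
    moreover have "L y \<in> S'" if "y \<in> S'" for y
      using that less.prems(2) sa[of x y] x by (simp add: S'_def)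
    ultimately obtain B where B: "finite B" "pairwise orthogonal B"
        "\<forall>x\<in>B. norm x = 1 \<and> (\<exists>c. L x = c *\<^sub>R x)" "span B = S'"
      using less.hyps[of S'] S' by blast
    have BS: "b \<in> S'" if "b \<in> B" for b using B(4) that span_base by blast
    have "span (insert x B) = S"
    proof (intro equalityI subsetI)
      fix y assume "y \<in> span (insert x B)"
      moreover have "insert x B \<subseteq> S" using BS x by (auto simp: S'_def)
      ultimately show "y \<in> S" using less.prems(1) span_minimal by blast
    next
      fix y assume "y \<in> S"
      then have "y - (x \<bullet> y) *\<^sub>R x \<in> S'"
        using less.prems(1) x xx by (simp add: S'_def subspace_diff subspace_scale inner_simps)
      then show "y \<in> span (insert x B)" using B(4) by (auto simp: span_breakdown_eq)
    qed
    moreover have "pairwise orthogonal (insert x B)"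
      using B(2) BS by (auto simp: pairwise_insert orthogonal_def S'_def inner_commute)
    ultimately show ?thesis
      using B x by (intro exI[of _ "insert x B"]) auto
  qed
qed

text \<open>A diagonalisation indexed by the coordinate type in arbitrary order, so that spectral
  sums run over \<open>UNIV\<close>. Only \<open>eigs\<close> and \<open>lam\<close> carry the
  sorted order.\<close>

definition eigensystem :: "real^'n^'n \<Rightarrow> ('n \<Rightarrow> real^'n) \<Rightarrow> ('n \<Rightarrow> real) \<Rightarrow> bool" where
  "eigensystem A q d \<longleftrightarrow> (\<forall>i j. q i \<bullet> q j = (if i = j then 1 else 0)) \<and> (\<forall>i. A *v q i = d i *\<^sub>R q i)"

lemma SymM_inner: "A \<in> SymM \<Longrightarrow> (A *v x) \<bullet> y = x \<bullet> (A *v y)"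
  by (metis (mono_tags, lifting) SymM_def dot_lmul_matrix matrix_vector_mul_lid mem_Collect_eq transpose_matrix_vector)

lemma symmetric_eigensystem_exists:
  fixes A :: "real^'n^'n"
  assumes A: "A \<in> SymM"
  obtains q d where "eigensystem A q d"
proof -
  obtain B where B: "finite B" "pairwise orthogonal B"
      "\<And>x. x \<in> B \<Longrightarrow> norm x = 1" "\<And>x. x \<in> B \<Longrightarrow> \<exists>c. A *v x = c *\<^sub>R x" "span B = (UNIV :: (real^'n) set)"
    using selfadjoint_orthonormal_eigenbasis_subspace[of "(*v) A" UNIV] SymM_inner[OF A] by auto
  have "0 \<notin> B" using B(3) by fastforce
  then have "independent B" using B(2) pairwise_orthogonal_independent by blast
  then have "card B = CARD('n)" using B(5) dim_span_eq_card_independent[of B] by simp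
  then obtain q where q: "bij_betw q (UNIV::'n set) B"
    using B(1) by (metis finite_code finite_same_card_bij)
  obtain d where d: "\<And>x. x \<in> B \<Longrightarrow> A *v x = d x *\<^sub>R x" using B(4) by metis
  have qB: "q i \<in> B" for i using q by (auto simp: bij_betw_def)
  have "eigensystem A q (d \<circ> q)"
    unfolding eigensystem_def
  proof (intro conjI allI)
    fix i j show "q i \<bullet> q j = (if i = j then 1 else 0)"
    proof (cases "i = j")
      case True then show ?thesis using B(3)[OF qB[of j]] by (simp add: norm_eq_1)
    next
      case False
      then have "q i \<noteq> q j" using q by (auto simp: bij_betw_def inj_eq)
      then show ?thesis using B(2) qB False by (auto simp: pairwise_def orthogonal_def)
    qed
    show "A *v q i = (d \<circ> q) i *\<^sub>R q i" using d[OF qB] by simp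
  qed
  then show ?thesis using that by blast
qed

lemma poly_det:
  fixes M :: "('a::comm_ring_1 poly)^'n^'n"
  shows "poly (det M) t = det (\<chi> i j. poly (M $ i $ j) t)"
  unfolding det_def by (simp add: poly_sum poly_prod)

text \<open>With Q the matrix of eigenvectors, (t - A) Q = Q (t - diag d) for every real t, and det
  Q is nonzero by orthonormality. Polynomials with equal values coincide.\<close>

lemma eigensystem_charpoly:
  fixes A :: "real^'n^'n"
  assumes "eigensystem A q d"
  shows "charpoly A = (\<Prod>i\<in>UNIV. [:- d i, 1:])"
proof (rule poly_ext)
  fix t
  define Q :: "real^'n^'n" where "Q = (\<chi> i j. q j $ i)"
  define D :: "real^'n^'n" where "D = (\<chi> i j. if i = j then t - d i else 0)"
  define T :: "real^'n^'n" where "T = (\<chi> i j. (if i = j then t else 0) - A $ i $ j)"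
  have "transpose Q ** Q = mat 1"
    using assms
    by (simp add: vec_eq_iff matrix_matrix_mult_def transpose_def Q_def mat_def eigensystem_def inner_vec_def)
  then have "det (transpose Q) * det Q = 1" by (metis det_I det_mul)
  then have Q: "det Q \<noteq> 0" by auto
  have "T ** Q = Q ** D"
  proof -
    have "(\<Sum>k\<in>UNIV. A $ i $ k * q j $ k) = d j * q j $ i" for i j
      using assms by (auto simp: eigensystem_def matrix_vector_mult_def vec_eq_iff)
    then show ?thesis
      by (simp add: vec_eq_iff matrix_matrix_mult_def T_def Q_def D_def left_diff_distrib sum_subtractf
          if_distrib[of "\<lambda>x. x * _"] if_distrib[of "\<lambda>x. _ * x"] algebra_simps cong: if_cong)
  qed
  then have "det T * det Q = det Q * det D" by (metis det_mul)
  then have "det T = det D" using Q by simp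
  also have "\<dots> = (\<Prod>i\<in>UNIV. t - d i)" by (subst det_diagonal) (auto simp: D_def)
  also have "det T = poly (charpoly A) t"
    unfolding charpoly_def poly_det
    by (rule arg_cong[where f=det]) (simp add: T_def vec_eq_iff)
  finally show "poly (charpoly A) t = poly (\<Prod>i\<in>UNIV. [:- d i, 1:]) t"
    by (simp add: poly_prod)
qed

text \<open>Bridges the sorted list of characteristic roots and an arbitrary diagonalisation.
  Equality of multisets suffices for symmetric functions such as \<open>Gop\<close> and for counting
  eigenvalues.\<close>

lemma eigensystem_eigs:
  assumes "eigensystem A q d"
  shows "mset (eigs A) = image_mset d (mset_set UNIV)" "sorted (eigs A)"
proof -
  have "proots (charpoly A) = (\<Sum>i\<in>UNIV. {#d i#})"
    unfolding eigensystem_charpoly[OF assms] by (subst proots_prod) auto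
  also have "\<dots> = image_mset d (mset_set UNIV)" by (simp add: sum_unfold_sum_mset)
  finally show "mset (eigs A) = image_mset d (mset_set UNIV)" by (simp add: eigs_def)
  show "sorted (eigs A)" by (simp add: eigs_def)
qed

lemma eigensystem_length_eigs:
  fixes A :: "real^'n^'n"
  assumes "eigensystem A q d" shows "length (eigs A) = CARD('n)"
  using arg_cong[OF eigensystem_eigs(1)[OF assms], of size] by simp

lemma eigensystem_Gop:
  fixes A :: "real^'n^'n"
  assumes "eigensystem A q d"
  shows "Gop A = (\<Sum>i\<in>UNIV. arctan (d i))"
proof -
  have "Gop A = (\<Sum>i<CARD('n). arctan (eigs A ! i))"
    unfolding Gop_def lam_def by (simp add: sum.atLeast1_atMost_eq)
  also have "\<dots> = sum_list (map arctan (eigs A))"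
    by (simp add: sum_list_sum_nth atLeast0LessThan eigensystem_length_eigs[OF assms])
  also have "\<dots> = sum_mset (image_mset arctan (mset (eigs A)))"
    by (metis mset_map sum_mset_sum_list)
  also have "\<dots> = (\<Sum>i\<in>UNIV. arctan (d i))"
    by (simp add: eigensystem_eigs(1)[OF assms] sum_unfold_sum_mset image_mset.compositionality comp_def)
  finally show ?thesis .
qed

lemma eigensystem_expand:
  assumes "eigensystem A q d"
  shows "(\<Sum>i\<in>UNIV. (x \<bullet> q i) *\<^sub>R q i) = x"
    and "(norm x)\<^sup>2 = (\<Sum>i\<in>UNIV. (x \<bullet> q i)\<^sup>2)"
    and "x \<bullet> (A *v x) = (\<Sum>i\<in>UNIV. d i * (x \<bullet> q i)\<^sup>2)"
proof -
  have o: "q i \<bullet> q j = (if i = j then 1 else 0)" for i j using assms by (simp add: eigensystem_def)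
  have inj: "inj q" by (rule injI) (metis o zero_neq_one)
  have po: "pairwise orthogonal (range q)"
    by (auto simp: pairwise_def orthogonal_def o)
  have n1: "norm y = 1" if "y \<in> range q" for y using that o by (auto simp: norm_eq_1)
  then have "0 \<notin> range q" by (metis norm_zero zero_neq_one)
  then have ind: "independent (range q)" using po pairwise_orthogonal_independent by blast
  have "card (range q) = DIM(real^'a)" using inj by (simp add: card_image)
  then have "span (range q) = UNIV" using ind card_eq_dim[of "range q" UNIV] by auto
  then have "(\<Sum>y\<in>range q. (x \<bullet> y) *\<^sub>R y) = x" using po n1 by (intro orthonormal_basis_expand) auto
  then show e: "(\<Sum>i\<in>UNIV. (x \<bullet> q i) *\<^sub>R q i) = x" using inj by (simp add: sum.reindex)
  have "x \<bullet> x = x \<bullet> (\<Sum>i\<in>UNIV. (x \<bullet> q i) *\<^sub>R q i)" by (simp only: e)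
  also have "\<dots> = (\<Sum>i\<in>UNIV. (x \<bullet> q i)\<^sup>2)" by (simp add: inner_sum_right power2_eq_square)
  finally show "(norm x)\<^sup>2 = (\<Sum>i\<in>UNIV. (x \<bullet> q i)\<^sup>2)" by (simp add: power2_norm_eq_inner)
  have "A *v x = A *v (\<Sum>i\<in>UNIV. (x \<bullet> q i) *\<^sub>R q i)" by (simp only: e)
  also have "\<dots> = (\<Sum>i\<in>UNIV. ((x \<bullet> q i) * d i) *\<^sub>R q i)"
    using assms by (simp add: eigensystem_def linear_sum[OF matrix_vector_mul_linear] linear_scale[OF matrix_vector_mul_linear])
  finally show "x \<bullet> (A *v x) = (\<Sum>i\<in>UNIV. d i * (x \<bullet> q i)\<^sup>2)"
    by (simp add: inner_sum_right power2_eq_square algebra_simps)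
qed

lemma eigensystem_span:
  assumes "eigensystem A q d"
  shows "dim (q ` J) = card J" and "\<And>x i. x \<in> span (q ` J) \<Longrightarrow> i \<notin> J \<Longrightarrow> x \<bullet> q i = 0"
proof -
  have o: "q i \<bullet> q j = (if i = j then 1 else 0)" for i j using assms by (simp add: eigensystem_def)
  have inj: "inj q" by (rule injI) (metis o zero_neq_one)
  have po: "pairwise orthogonal (q ` J)"
    by (auto simp: pairwise_def orthogonal_def o)
  have "0 \<notin> q ` J" using o by (metis imageE inner_zero_left zero_neq_one)
  then have "independent (q ` J)" using po pairwise_orthogonal_independent by blast
  then show "dim (q ` J) = card J"
    using inj by (metis card_image dim_eq_card_independent inj_on_subset subset_UNIV)
  fix x i assume x: "x \<in> span (q ` J)" and i: "i \<notin> J"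
  have "orthogonal (q i) x"
    using x by (rule orthogonal_to_span) (use i o in \<open>auto simp: orthogonal_def\<close>)
  then show "x \<bullet> q i = 0" by (simp add: orthogonal_def inner_commute)
qed

section \<open>Monotonicity of the eigenvalues in the matrix order\<close>

lemma eigs_filter_card:
  assumes "eigensystem A q d"
  shows "card {k. k < length (eigs A) \<and> P (eigs A ! k)} = card {i. P (d i)}"
proof -
  have "card {k. k < length (eigs A) \<and> P (eigs A ! k)} = size (filter_mset P (mset (eigs A)))"
    by (metis length_filter_conv_card mset_filter size_mset)
  also have "\<dots> = card {i. P (d i)}"
    by (simp add: eigensystem_eigs(1)[OF assms] filter_mset_image_mset)
  finally show ?thesis .
qed

text \<open>A dimension count in the manner of Courant and Fischer. If the claim failed, with
  \<open>t\<close> the entry of \<open>B\<close>, the eigenvectors of \<open>A\<close> above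
  \<open>t\<close> and those of \<open>B\<close> not above \<open>t\<close> would span spaces
  sharing a nonzero \<open>x\<close>. There the form of \<open>A\<close> exceeds
  \<open>t * (norm x)\<^sup>2\<close> and that of \<open>B\<close> does not.\<close>

lemma eigs_mono:
  fixes A B :: "real^'n^'n"
  assumes A: "A \<in> SymM" and B: "B \<in> SymM" and le: "psd_le A B" and i: "i < CARD('n)"
  shows "eigs A ! i \<le> eigs B ! i"
proof (rule ccontr)
  obtain q d where d: "eigensystem A q d" using symmetric_eigensystem_exists[OF A] .
  obtain r e where e: "eigensystem B r e" using symmetric_eigensystem_exists[OF B] .
  define t where "t = eigs B ! i"
  assume "\<not> eigs A ! i \<le> eigs B ! i"
  then have t: "t < eigs A ! i" by (simp add: t_def)
  define J where "J = {j. t < d j}"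
  define I where "I = {j. e j \<le> t}"
  \<comment> \<open>\<open>eigs\<close> is indexed from 0: the positions from \<open>i\<close> on
    give at least N - i eigenvalues of \<open>A\<close> above \<open>t\<close>, the positions up to
    \<open>i\<close> give i + 1 eigenvalues of \<open>B\<close> at most \<open>t\<close>. The total
    N + 1 exceeds the dimension.\<close>
  have "{i..<CARD('n)} \<subseteq> {k. k < length (eigs A) \<and> t < eigs A ! k}"
    using t eigensystem_eigs(2)[OF d] eigensystem_length_eigs[OF d]
    by (auto dest: sorted_nth_mono)
  from card_mono[OF _ this] have J: "CARD('n) - i \<le> card J"
    unfolding J_def eigs_filter_card[OF d, of "\<lambda>x. t < x"] by simp
  have "{..i} \<subseteq> {k. k < length (eigs B) \<and> eigs B ! k \<le> t}"
    using i eigensystem_eigs(2)[OF e] eigensystem_length_eigs[OF e]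
    by (auto simp: t_def intro: sorted_nth_mono)
  from card_mono[OF _ this] have I: "Suc i \<le> card I"
    unfolding I_def eigs_filter_card[OF e, of "\<lambda>x. x \<le> t"] by simp
  let ?S = "span (q ` J)" and ?T = "span (r ` I)"
  have "dim {x + y |x y. x \<in> ?S \<and> y \<in> ?T} + dim (?S \<inter> ?T) = card J + card I"
    using dim_sums_Int[of ?S ?T] by (simp add: eigensystem_span(1)[OF d] eigensystem_span(1)[OF e])
  moreover have "dim {x + y |x y. x \<in> ?S \<and> y \<in> ?T} \<le> CARD('n)"
    using dim_subset_UNIV[of "{x + y |x y. x \<in> ?S \<and> y \<in> ?T}"] by simp
  ultimately have "dim (?S \<inter> ?T) \<noteq> 0" using I J i by linarith
  then obtain x where x: "x \<in> ?S" "x \<in> ?T" "x \<noteq> 0" unfolding dim_eq_0 by blast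
  have "0 < (norm x)\<^sup>2" using x by simp
  then have "(\<Sum>i\<in>UNIV. (x \<bullet> q i)\<^sup>2) \<noteq> 0" unfolding eigensystem_expand(2)[OF d, of x] by simp
  then have "\<exists>j. x \<bullet> q j \<noteq> 0" by (rule contrapos_np) simp
  then obtain j where j: "x \<bullet> q j \<noteq> 0" by blast
  have z: "d k \<le> t \<Longrightarrow> x \<bullet> q k = 0" for k
    using eigensystem_span(2)[OF d x(1), of k] by (auto simp: J_def)
  have "t * (norm x)\<^sup>2 = (\<Sum>k\<in>UNIV. t * (x \<bullet> q k)\<^sup>2)"
    by (simp add: eigensystem_expand(2)[OF d] sum_distrib_left)
  also have "\<dots> < (\<Sum>k\<in>UNIV. d k * (x \<bullet> q k)\<^sup>2)"
  proof (rule sum_strict_mono_ex1)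
    show "\<forall>k\<in>UNIV. t * (x \<bullet> q k)\<^sup>2 \<le> d k * (x \<bullet> q k)\<^sup>2"
    proof
      fix k show "t * (x \<bullet> q k)\<^sup>2 \<le> d k * (x \<bullet> q k)\<^sup>2"
        using z[of k] by (cases "d k \<le> t") (auto intro: mult_right_mono)
    qed
    have "t < d j" using z[of j] j by force
    then show "\<exists>k\<in>UNIV. t * (x \<bullet> q k)\<^sup>2 < d k * (x \<bullet> q k)\<^sup>2"
      using j by (intro bexI[of _ j]) auto
  qed simp
  also have "\<dots> = x \<bullet> (A *v x)" by (simp add: eigensystem_expand(3)[OF d])
  also have "\<dots> \<le> x \<bullet> (B *v x)"
    using le by (simp add: psd_le_def matrix_vector_mult_diff_rdistrib inner_simps)
  also have "\<dots> = (\<Sum>k\<in>UNIV. e k * (x \<bullet> r k)\<^sup>2)" by (simp add: eigensystem_expand(3)[OF e])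
  also have "\<dots> \<le> (\<Sum>k\<in>UNIV. t * (x \<bullet> r k)\<^sup>2)"
  proof (rule sum_mono)
    fix k show "e k * (x \<bullet> r k)\<^sup>2 \<le> t * (x \<bullet> r k)\<^sup>2"
      using eigensystem_span(2)[OF e x(2), of k]
      by (cases "e k \<le> t") (auto simp: I_def intro: mult_right_mono)
  qed
  also have "\<dots> = t * (norm x)\<^sup>2"
    by (simp add: eigensystem_expand(2)[OF e] sum_distrib_left)
  finally show False by simp
qed

lemma Gop_mono:
  fixes A B :: "real^'n^'n"
  assumes "A \<in> SymM" "B \<in> SymM" "psd_le A B"
  shows "Gop A \<le> Gop B"
  unfolding Gop_def lam_def
  using eigs_mono[OF assms] by (intro sum_mono) (auto simp: arctan_le_iff)

lemma mat_scale_vector [simp]: "(c *\<^sub>R mat 1 :: real^'n^'n) *v x = c *\<^sub>R x"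
  by (simp add: scaleR_matrix_vector_assoc[symmetric])

lemma eigensystem_shift:
  assumes "eigensystem A q d"
  shows "eigensystem (A + c *\<^sub>R mat 1) q (\<lambda>i. d i + c)"
  using assms by (simp add: eigensystem_def matrix_vector_mult_add_rdistrib scaleR_left_distrib)

lemma SymM_shift: "A \<in> SymM \<Longrightarrow> A + c *\<^sub>R mat 1 \<in> SymM"
  by (simp add: SymM_def transpose_def vec_eq_iff mat_def)

lemma eigensystem_scaled_identity: "eigensystem (c *\<^sub>R mat 1 :: real^'n^'n) (\<lambda>i. axis i 1) (\<lambda>i. c)"
  by (simp add: eigensystem_def inner_axis_axis)

lemma lam_scaled_identity:
  assumes "i \<in> {1..CARD('n)}"
  shows "lam (c *\<^sub>R mat 1 :: real^'n^'n) i = c"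
proof -
  let ?A = "c *\<^sub>R mat 1 :: real^'n^'n"
  have "set (eigs ?A) = {c}"
    using arg_cong[OF eigensystem_eigs(1)[OF eigensystem_scaled_identity[where 'n='n, of c]], of set_mset] by simp
  moreover have "i - 1 < length (eigs ?A)"
    using assms eigensystem_length_eigs[OF eigensystem_scaled_identity[where 'n='n, of c]] by auto
  ultimately show ?thesis unfolding lam_def using nth_mem by blast
qed

section \<open>Semiconvex functions and quadratic test functions\<close>

text \<open>This is convexity of \<open>f x + K / 2 * (norm x)\<^sup>2\<close>, as
  \<open>semiconvex_iff_convex_on\<close> shows.\<close>

definition semiconvex :: "real \<Rightarrow> ('a::euclidean_space \<Rightarrow> real) \<Rightarrow> bool" where
  "semiconvex K f \<longleftrightarrow> (\<forall>x y t. 0 \<le> t \<longrightarrow> t \<le> 1 \<longrightarrow>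
     f ((1 - t) *\<^sub>R x + t *\<^sub>R y) \<le> (1 - t) * f x + t * f y + K / 2 * (t * (1 - t)) * (norm (x - y))\<^sup>2)"

definition upper_test :: "('a::euclidean_space \<Rightarrow> real) \<Rightarrow> 'a \<Rightarrow> 'a \<Rightarrow> ('a \<Rightarrow> 'a) \<Rightarrow> bool" where
  "upper_test f z p L \<longleftrightarrow> linear L \<and>
     (\<exists>r>0. \<forall>w. norm w < r \<longrightarrow> f (z + w) \<le> f z + p \<bullet> w + (w \<bullet> L w) / 2)"

lemma semiconvexD:
  assumes "semiconvex K f" "0 \<le> t" "t \<le> 1"
  shows "f ((1 - t) *\<^sub>R x + t *\<^sub>R y)
    \<le> (1 - t) * f x + t * f y + K / 2 * (t * (1 - t)) * (norm (x - y))\<^sup>2"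
  using assms unfolding semiconvex_def by blast

lemma quadratic_form_convex_combination:
  fixes L :: "'a::real_inner \<Rightarrow> 'a"
  assumes "linear L"
  shows "((1 - t) *\<^sub>R x + t *\<^sub>R y) \<bullet> L ((1 - t) *\<^sub>R x + t *\<^sub>R y)
    = (1 - t) * (x \<bullet> L x) + t * (y \<bullet> L y) - t * (1 - t) * ((x - y) \<bullet> L (x - y))"
  using assms by (simp add: linear_add linear_scale linear_diff inner_simps algebra_simps)

lemma norm_convex_combination:
  fixes x y :: "'a::real_inner"
  shows "(norm ((1 - t) *\<^sub>R x + t *\<^sub>R y))\<^sup>2
    = (1 - t) * (norm x)\<^sup>2 + t * (norm y)\<^sup>2 - t * (1 - t) * (norm (x - y))\<^sup>2"
  unfolding power2_norm_eq_inner
  using quadratic_form_convex_combination[OF linear_id, of t x y] by simp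

lemma semiconvex_iff_convex_on:
  "semiconvex K f \<longleftrightarrow> convex_on UNIV (\<lambda>x. f x + K / 2 * (norm x)\<^sup>2)"
proof -
  have "f ((1 - t) *\<^sub>R x + t *\<^sub>R y) + K / 2 * (norm ((1 - t) *\<^sub>R x + t *\<^sub>R y))\<^sup>2
      \<le> (1 - t) * (f x + K / 2 * (norm x)\<^sup>2) + t * (f y + K / 2 * (norm y)\<^sup>2) \<longleftrightarrow>
      f ((1 - t) *\<^sub>R x + t *\<^sub>R y)
      \<le> (1 - t) * f x + t * f y + K / 2 * (t * (1 - t)) * (norm (x - y))\<^sup>2" for x y t
    unfolding norm_convex_combination
    by (simp add: algebra_simps add_divide_distrib diff_divide_distrib)
  then show ?thesis
    unfolding semiconvex_def
    by (auto intro!: convex_onI dest: convex_onD)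
qed

lemma semiconvex_continuous_on:
  assumes "semiconvex K f" shows "continuous_on S f"
proof -
  have "continuous_on UNIV (\<lambda>x. f x + K / 2 * (norm x)\<^sup>2)"
    using assms by (auto simp: semiconvex_iff_convex_on intro!: convex_on_continuous)
  then have "continuous_on UNIV (\<lambda>x. (f x + K / 2 * (norm x)\<^sup>2) - K / 2 * (norm x)\<^sup>2)"
    by (rule continuous_on_diff) (intro continuous_intros)
  then show ?thesis by (auto intro: continuous_on_subset)
qed

lemma semiconvex_add:
  assumes "semiconvex K f" "semiconvex K' g"
  shows "semiconvex (K + K') (\<lambda>x. f x + g x)"
  using convex_on_add[OF assms[unfolded semiconvex_iff_convex_on]]
  by (simp add: semiconvex_iff_convex_on algebra_simps add_divide_distrib)

lemma semiconvex_minus_quadratic_form: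
  fixes L :: "'a::euclidean_space \<Rightarrow> 'a"
  assumes "linear L" "\<And>v. v \<bullet> L v \<le> \<mu> * (norm v)\<^sup>2"
  shows "semiconvex \<mu> (\<lambda>x. c - p \<bullet> x - (x \<bullet> L x) / 2)"
  unfolding semiconvex_def
proof (intro allI impI)
  fix x y :: 'a and t :: real assume t: "0 \<le> t" "t \<le> 1"
  have "t * (1 - t) * ((x - y) \<bullet> L (x - y)) \<le> t * (1 - t) * (\<mu> * (norm (x - y))\<^sup>2)"
    using t assms(2) by (intro mult_left_mono) auto
  then show "c - p \<bullet> ((1 - t) *\<^sub>R x + t *\<^sub>R y)
        - (((1 - t) *\<^sub>R x + t *\<^sub>R y) \<bullet> L ((1 - t) *\<^sub>R x + t *\<^sub>R y)) / 2
      \<le> (1 - t) * (c - p \<bullet> x - (x \<bullet> L x) / 2) + t * (c - p \<bullet> y - (y \<bullet> L y) / 2)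
        + \<mu> / 2 * (t * (1 - t)) * (norm (x - y))\<^sup>2"
    unfolding quadratic_form_convex_combination[OF assms(1)]
    by (simp add: inner_simps algebra_simps add_divide_distrib diff_divide_distrib)
qed

lemma semiconvex_translate:
  fixes f :: "'a::euclidean_space \<Rightarrow> real"
  assumes "semiconvex K f" shows "semiconvex K (\<lambda>x. f (a + x))"
  unfolding semiconvex_def
proof (intro allI impI)
  fix x y :: 'a and t :: real assume t: "0 \<le> t" "t \<le> 1"
  have "a + ((1 - t) *\<^sub>R x + t *\<^sub>R y) = (1 - t) *\<^sub>R (a + x) + t *\<^sub>R (a + y)"
    by (simp add: algebra_simps)
  then show "f (a + ((1 - t) *\<^sub>R x + t *\<^sub>R y))
      \<le> (1 - t) * f (a + x) + t * f (a + y) + K / 2 * (t * (1 - t)) * (norm (x - y))\<^sup>2"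
    using semiconvexD[OF assms t, of "a + x" "a + y"] by simp
qed

lemma semiconvex_rescale:
  fixes f :: "'a::euclidean_space \<Rightarrow> real"
  assumes "semiconvex K f" "r > 0" shows "semiconvex K (\<lambda>x. f (r *\<^sub>R x) / r\<^sup>2)"
  unfolding semiconvex_def
proof (intro allI impI)
  fix x y :: 'a and t :: real assume t: "0 \<le> t" "t \<le> 1"
  have "r *\<^sub>R ((1 - t) *\<^sub>R x + t *\<^sub>R y) = (1 - t) *\<^sub>R (r *\<^sub>R x) + t *\<^sub>R (r *\<^sub>R y)"
    by (simp add: algebra_simps)
  moreover have "norm (r *\<^sub>R x - r *\<^sub>R y) = r * norm (x - y)"
    using assms(2) by (metis abs_of_pos norm_scaleR scaleR_diff_right)
  ultimately have "f (r *\<^sub>R ((1 - t) *\<^sub>R x + t *\<^sub>R y))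
      \<le> (1 - t) * f (r *\<^sub>R x) + t * f (r *\<^sub>R y) + K / 2 * (t * (1 - t)) * (r * norm (x - y))\<^sup>2"
    using semiconvexD[OF assms(1) t, of "r *\<^sub>R x" "r *\<^sub>R y"] by simp
  then have "f (r *\<^sub>R ((1 - t) *\<^sub>R x + t *\<^sub>R y)) / r\<^sup>2
      \<le> ((1 - t) * f (r *\<^sub>R x) + t * f (r *\<^sub>R y) + K / 2 * (t * (1 - t)) * (r * norm (x - y))\<^sup>2) / r\<^sup>2"
    by (rule divide_right_mono) simp
  also have "\<dots> = (1 - t) * (f (r *\<^sub>R x) / r\<^sup>2) + t * (f (r *\<^sub>R y) / r\<^sup>2)
      + K / 2 * (t * (1 - t)) * (norm (x - y))\<^sup>2"
    using assms(2) by (simp add: add_divide_distrib power_mult_distrib)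
  finally show "f (r *\<^sub>R ((1 - t) *\<^sub>R x + t *\<^sub>R y)) / r\<^sup>2
      \<le> (1 - t) * (f (r *\<^sub>R x) / r\<^sup>2) + t * (f (r *\<^sub>R y) / r\<^sup>2)
      + K / 2 * (t * (1 - t)) * (norm (x - y))\<^sup>2" .
qed

text \<open>Compare \<open>f z\<close> with the mean of \<open>f\<close> at z + s v and z - s v: the
  gradient terms cancel, and semiconvexity bounds the remaining second-order term from
  below.\<close>

lemma upper_test_semiconvex_lower_bound:
  assumes sc: "semiconvex K f" and "upper_test f z p L"
  shows "- K * (norm v)\<^sup>2 \<le> v \<bullet> L v"
proof (cases "v = 0")
  case True then show ?thesis by simp
next
  case False
  obtain r where L: "linear L" and r: "r > 0"
    and le: "\<And>w. norm w < r \<Longrightarrow> f (z + w) \<le> f z + p \<bullet> w + (w \<bullet> L w) / 2"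
    using assms(2) unfolding upper_test_def by auto
  define s where "s = r / (2 * norm v)"
  have s: "s > 0" "norm (s *\<^sub>R v) < r" using r False by (auto simp: s_def)
  have "f z \<le> f (z + s *\<^sub>R v) / 2 + f (z + s *\<^sub>R (- v)) / 2 + K / 8 * (2 * s * norm v)\<^sup>2"
  proof -
    have e: "(1 / 2) *\<^sub>R (z + s *\<^sub>R v) + (1 / 2) *\<^sub>R (z + s *\<^sub>R (- v)) = z"
      by (simp add: algebra_simps flip: scaleR_left_distrib)
    have "z + s *\<^sub>R v - (z + s *\<^sub>R (- v)) = (2 * s) *\<^sub>R v" by (simp add: scaleR_2 flip: scaleR_scaleR)
    then have "norm (z + s *\<^sub>R v - (z + s *\<^sub>R (- v))) = 2 * s * norm v" using s by simp
    with semiconvexD[OF sc, of "1/2" "z + s *\<^sub>R v" "z + s *\<^sub>R (- v)"] e show ?thesis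
      by simp
  qed
  moreover have "f (z + s *\<^sub>R v) \<le> f z + s * (p \<bullet> v) + s\<^sup>2 * (v \<bullet> L v) / 2"
    using le[OF s(2)] L by (simp add: linear_scale power2_eq_square)
  moreover have "f (z + s *\<^sub>R (- v)) \<le> f z - s * (p \<bullet> v) + s\<^sup>2 * (v \<bullet> L v) / 2"
    using le[of "s *\<^sub>R (- v)"] s L by (simp add: linear_scale linear_neg power2_eq_square)
  ultimately have "0 \<le> s\<^sup>2 * (v \<bullet> L v + K * (norm v)\<^sup>2)"
    by (simp add: power_mult_distrib algebra_simps)
  then show ?thesis using s by (simp add: zero_le_mult_iff)
qed

section \<open>The Hopf barrier and the quantitative strong maximum principle\<close>

lemma exp_lower_quadratic:
  fixes t :: real assumes "\<bar>t\<bar> \<le> 1 / 3" shows "1 + t + t\<^sup>2 / 3 \<le> exp t"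
proof -
  obtain s where s: "\<bar>s\<bar> \<le> \<bar>t\<bar>" and e: "exp t = (\<Sum>m<2. t ^ m / fact m) + exp s / fact 2 * t ^ 2"
    using Maclaurin_exp_le[of t 2] by blast
  \<comment> \<open>The Lagrange remainder has coefficient \<open>exp s / 2\<close>, and s \<ge>
    -1/3 makes it at least 1/3.\<close>
  have "2 / 3 \<le> exp s" using exp_ge_add_one_self[of s] s assms by linarith
  then have "(2 / 3) / 2 * t\<^sup>2 \<le> exp s / 2 * t\<^sup>2" by (intro mult_right_mono divide_right_mono) auto
  moreover have "exp t = 1 + t + exp s / 2 * t\<^sup>2" using e by (simp add: numeral_2_eq_2)
  ultimately show ?thesis by simp
qed

text \<open>The exponent changes by a small \<open>t\<close>, to which
  \<open>exp_lower_quadratic\<close> applies. The second-order coefficients are weaker than those of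
  the Taylor expansion; the slack absorbs the terms of higher order.\<close>

lemma gaussian_lower_quadratic:
  fixes w :: "'a::real_inner"
  assumes \<alpha>: "\<alpha> > 0"
  shows "\<exists>r>0. \<forall>v. norm v < r \<longrightarrow> exp (- \<alpha> * (norm w)\<^sup>2)
      * (1 - 2 * \<alpha> * (w \<bullet> v) - 2 * \<alpha> * (norm v)\<^sup>2 + 2 / 3 * \<alpha>\<^sup>2 * (w \<bullet> v)\<^sup>2)
    \<le> exp (- \<alpha> * (norm (w + v))\<^sup>2)"
proof -
  \<comment> \<open>The bounds serve to get |v|^2 \<le> |v|, then \<alpha> |v|^2 \<le> 1, and
    finally |t| \<le> 1/3 as the exponential bound needs.\<close>
  define r where "r = min 1 (min (1 / \<alpha>) (1 / (3 * \<alpha> * (2 * norm w + 1))))"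
  have pos: "2 * norm w + 1 > 0" using norm_ge_zero[of w] by linarith
  have r: "r > 0" using \<alpha> pos by (simp add: r_def)
  show ?thesis
  proof (intro exI[of _ r] conjI allI impI r)
    fix v :: 'a assume "norm v < r"
    then have v1: "norm v \<le> 1" and v2: "norm v \<le> 1 / \<alpha>"
      and v3: "norm v \<le> 1 / (3 * \<alpha> * (2 * norm w + 1))" by (auto simp: r_def)
    have vv: "(norm v)\<^sup>2 \<le> norm v" using v1 by (simp add: power2_eq_square mult_left_le_one_le)
    define t where "t = - \<alpha> * (2 * (w \<bullet> v) + (norm v)\<^sup>2)"
    have "\<bar>2 * (w \<bullet> v) + (norm v)\<^sup>2\<bar> \<le> 2 * (norm w * norm v) + norm v"
      using Cauchy_Schwarz_ineq2[of w v] vv zero_le_power2[of "norm v"] by linarith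
    then have "\<bar>t\<bar> \<le> \<alpha> * (2 * (norm w * norm v) + norm v)"
      using \<alpha> by (simp add: t_def abs_mult)
    also have "\<dots> = norm v * (\<alpha> * (2 * norm w + 1))" by (simp add: algebra_simps)
    also have "\<dots> \<le> 1 / (3 * \<alpha> * (2 * norm w + 1)) * (\<alpha> * (2 * norm w + 1))"
      using v3 \<alpha> pos by (intro mult_right_mono) auto
    also have "\<dots> = 1 / 3" using \<alpha> pos by (simp add: divide_eq_eq)
    finally have "1 + t + t\<^sup>2 / 3 \<le> exp t" by (rule exp_lower_quadratic)
    moreover have "1 - 2 * \<alpha> * (w \<bullet> v) - 2 * \<alpha> * (norm v)\<^sup>2 + 2 / 3 * \<alpha>\<^sup>2 * (w \<bullet> v)\<^sup>2 \<le> 1 + t + t\<^sup>2 / 3"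
    proof -
      \<comment> \<open>Expanding this square gives (2a + b)^2 \<ge> 2 a^2 - b^2 with a = w . v and
        b = |v|^2, which removes the mixed term.\<close>
      have "0 \<le> (2 * (w \<bullet> v) + 2 * (norm v)\<^sup>2)\<^sup>2" by simp
      then have "2 * (w \<bullet> v)\<^sup>2 - ((norm v)\<^sup>2)\<^sup>2 \<le> (2 * (w \<bullet> v) + (norm v)\<^sup>2)\<^sup>2"
        by (simp add: power2_eq_square algebra_simps)
      then have "\<alpha>\<^sup>2 * (2 * (w \<bullet> v)\<^sup>2 - ((norm v)\<^sup>2)\<^sup>2) \<le> t\<^sup>2"
        by (simp add: t_def power_mult_distrib mult_left_mono)
      moreover have "\<alpha>\<^sup>2 * ((norm v)\<^sup>2)\<^sup>2 \<le> \<alpha> * (norm v)\<^sup>2"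
      proof -
        have "\<alpha> * (norm v)\<^sup>2 \<le> \<alpha> * (1 / \<alpha>)" using vv v2 \<alpha> by (intro mult_left_mono) auto
        then have "\<alpha> * (norm v)\<^sup>2 \<le> 1" using \<alpha> by simp
        then have "(\<alpha> * (norm v)\<^sup>2) * (\<alpha> * (norm v)\<^sup>2) \<le> \<alpha> * (norm v)\<^sup>2"
          using \<alpha> by (intro mult_left_le) auto
        then show ?thesis by (simp add: power2_eq_square algebra_simps)
      qed
      moreover have "0 \<le> \<alpha> * (norm v)\<^sup>2" using \<alpha> by simp
      ultimately show ?thesis by (simp add: t_def algebra_simps)
    qed
    ultimately have "1 - 2 * \<alpha> * (w \<bullet> v) - 2 * \<alpha> * (norm v)\<^sup>2 + 2 / 3 * \<alpha>\<^sup>2 * (w \<bullet> v)\<^sup>2 \<le> exp t"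
      by linarith
    then have "exp (- \<alpha> * (norm w)\<^sup>2)
        * (1 - 2 * \<alpha> * (w \<bullet> v) - 2 * \<alpha> * (norm v)\<^sup>2 + 2 / 3 * \<alpha>\<^sup>2 * (w \<bullet> v)\<^sup>2)
      \<le> exp (- \<alpha> * (norm w)\<^sup>2) * exp t" by (rule mult_left_mono) simp
    also have "\<dots> = exp (- \<alpha> * (norm (w + v))\<^sup>2)"
      by (simp add: t_def power2_norm_eq_inner inner_simps inner_commute algebra_simps flip: exp_add)
    finally show "exp (- \<alpha> * (norm w)\<^sup>2)
        * (1 - 2 * \<alpha> * (w \<bullet> v) - 2 * \<alpha> * (norm v)\<^sup>2 + 2 / 3 * \<alpha>\<^sup>2 * (w \<bullet> v)\<^sup>2)
      \<le> exp (- \<alpha> * (norm (w + v))\<^sup>2)" .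
  qed
qed

text \<open>\<delta> depends only on \<eta>, K, \<theta> and the dimension, not on \<open>g\<close>,
  so the estimate applies to the rescalings of one function at every scale. The test condition makes
  \<open>g\<close> almost a subsolution for the operator "largest eigenvalue plus \<theta> times
  trace"; a value below -\<eta> on the unit sphere would make a barrier produce a forbidden
  test.\<close>

lemma semiconvex_hopf_estimate:
  fixes \<eta> K \<theta> :: real
  assumes \<eta>: "\<eta> > 0" and K: "K \<ge> 0" and \<theta>: "\<theta> > 0"
  shows "\<exists>\<delta>>0. \<forall>g :: 'a::euclidean_space \<Rightarrow> real. semiconvex K g \<longrightarrow> (\<forall>y. norm y \<le> 3 \<longrightarrow> g y \<le> 0)
    \<longrightarrow> g 0 = 0
    \<longrightarrow> (\<forall>y p L \<mu>. norm y \<le> 3 \<longrightarrow> upper_test g y p L \<longrightarrow> (\<forall>v. v \<bullet> L v \<le> \<mu> * (norm v)\<^sup>2)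
          \<longrightarrow> - \<delta> < \<mu> + \<theta> * (\<Sum>b\<in>Basis. b \<bullet> L b))
    \<longrightarrow> (\<forall>y. norm y = 1 \<longrightarrow> - \<eta> \<le> g y)"
proof -
  \<comment> \<open>This \<open>s\<close> makes semiconvexity keep \<open>g\<close> below -a =
    -\<eta>/2 on the sphere of radius \<open>s\<close> about a point where g < -\<eta>.
    \<open>\<alpha>\<close> is chosen so that the concave radial part of the barrier outweighs all
    other terms, and \<open>\<delta>\<close> bounds a \<alpha> exp(-\<alpha> |w|^2) from below for
    |w| \<le> 2.\<close>
  define s where "s = \<eta> / (2 * \<eta> + K)"
  define a where "a = \<eta> / 2"
  define d where "d = real DIM('a)"
  define \<alpha> where "\<alpha> = (5 + 4 * d * \<theta>) / (4 / 3 * \<theta> * s\<^sup>2)"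
  define \<delta> where "\<delta> = a * \<alpha> * exp (- 4 * \<alpha>)"
  have d: "d > 0" by (simp add: d_def)
  have den: "2 * \<eta> + K > 0" using \<eta> K by linarith
  have s: "s > 0" "s < 1" using \<eta> K den by (auto simp: s_def divide_less_eq)
  have a: "a > 0" using \<eta> by (simp add: a_def)
  have \<alpha>: "\<alpha> > 0" unfolding \<alpha>_def using \<theta> s d by (intro divide_pos_pos add_pos_pos) auto
  have \<alpha>e: "4 / 3 * \<alpha> * \<theta> * s\<^sup>2 = 5 + 4 * d * \<theta>"
    using \<theta> s by (simp add: \<alpha>_def)
  have \<delta>: "\<delta> > 0" using a \<alpha> by (simp add: \<delta>_def)
  show ?thesis
  proof (intro exI[of _ \<delta>] conjI allI impI \<delta>, rule ccontr)
    fix g :: "'a \<Rightarrow> real" and y1 :: 'a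
    assume sc: "semiconvex K g" and neg: "\<forall>y. norm y \<le> 3 \<longrightarrow> g y \<le> 0" and g0: "g 0 = 0"
      and tests: "\<forall>y p L \<mu>. norm y \<le> 3 \<longrightarrow> upper_test g y p L \<longrightarrow> (\<forall>v. v \<bullet> L v \<le> \<mu> * (norm v)\<^sup>2)
          \<longrightarrow> - \<delta> < \<mu> + \<theta> * (\<Sum>b\<in>Basis. b \<bullet> L b)"
      and y1: "norm y1 = 1" and "\<not> - \<eta> \<le> g y1"
    then have gy1: "g y1 < - \<eta>" by simp
    have small: "g y \<le> - a" if y: "norm (y - y1) = s" for y
    proof -
      \<comment> \<open>\<open>y\<close> lies on the segment from \<open>y1\<close> to
        \<open>e\<close>; since \<open>e\<close> has distance 1 from \<open>y1\<close>, it stays in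
        the ball where \<open>g\<close> is nonpositive.\<close>
      define e where "e = y1 + (1 / s) *\<^sub>R (y - y1)"
      have ye: "y = (1 - s) *\<^sub>R y1 + s *\<^sub>R e" using s by (simp add: e_def algebra_simps)
      have ne: "norm (y1 - e) = 1" using s y by (simp add: e_def)
      then have "norm e \<le> 3" using y1 norm_triangle_ineq4[of y1 "y1 - e"] by simp
      then have ge: "g e \<le> 0" using neg by blast
      have "g y \<le> (1 - s) * g y1 + s * g e + K / 2 * (s * (1 - s))"
        using semiconvexD[OF sc, of s y1 e] s ne ye by simp
      also have "\<dots> \<le> (1 - s) * (- \<eta>) + 0 + K / 2 * s"
        using s gy1 ge K by (intro add_mono mult_left_mono) (auto simp: mult_le_0_iff)
      also have "\<dots> = - \<eta> + s * (2 * \<eta> + K) / 2" by (simp add: algebra_simps)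
      also have "\<dots> = - a" using den by (simp add: s_def a_def)
      finally show ?thesis .
    qed
    \<comment> \<open>The barrier vanishes at distance 2 from \<open>y1\<close> and is at least -a
      at distance \<open>s\<close>, while \<psi> 0 < 0 = g 0. So g - \<psi> is positive at 0 but
      nonpositive on both boundary spheres of the annulus \<open>C\<close>, and its maximum over
      \<open>C\<close> is interior.\<close>
    define \<psi> where "\<psi> = (\<lambda>y. - a * (exp (- \<alpha> * (norm (y - y1))\<^sup>2) - exp (- 4 * \<alpha>)))"
    define C where "C = {y. s \<le> norm (y - y1) \<and> norm (y - y1) \<le> 2}"
    have "C = cball y1 2 - ball y1 s" by (auto simp: C_def dist_norm norm_minus_commute)
    then have "compact C" by (simp add: compact_diff)
    moreover have C0: "0 \<in> C" using y1 s by (simp add: C_def)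
    moreover have "continuous_on C (\<lambda>y. g y - \<psi> y)"
      unfolding \<psi>_def by (intro continuous_intros semiconvex_continuous_on[OF sc])
    ultimately obtain ys where ys: "ys \<in> C" and mx: "\<And>y. y \<in> C \<Longrightarrow> g y - \<psi> y \<le> g ys - \<psi> ys"
      using continuous_attains_sup[of C "\<lambda>y. g y - \<psi> y"] by blast
    have nys: "norm ys \<le> 3"
      using ys y1 norm_triangle_sub[of ys y1] by (simp add: C_def)
    have "\<psi> 0 < 0" using a \<alpha> y1 by (simp add: \<psi>_def)
    then have pos: "g ys - \<psi> ys > 0" using mx[OF C0] g0 by linarith
    have n2: "norm (ys - y1) \<noteq> 2"
    proof
      assume "norm (ys - y1) = 2"
      then have "\<psi> ys = 0" by (simp add: \<psi>_def)
      then show False using pos neg nys by force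
    qed
    have ns: "norm (ys - y1) \<noteq> s"
    proof
      assume e: "norm (ys - y1) = s"
      have "exp (- \<alpha> * s\<^sup>2) - exp (- 4 * \<alpha>) \<le> 1"
      proof -
        have "exp (- \<alpha> * s\<^sup>2) \<le> 1" using \<alpha> by simp
        moreover have "exp (- 4 * \<alpha>) > 0" by simp
        ultimately show ?thesis by linarith
      qed
      then have "\<psi> ys \<ge> - a" using a by (simp add: \<psi>_def e mult_left_le)
      then show False using pos small[OF e] by linarith
    qed
    define w where "w = ys - y1"
    have w: "s < norm w" "norm w < 2" using ys n2 ns by (auto simp: C_def w_def)
    define E where "E = exp (- \<alpha> * (norm w)\<^sup>2)"
    have E: "E > 0" by (simp add: E_def)
    obtain r0 where r0: "r0 > 0" and gauss: "\<And>v. norm v < r0 \<Longrightarrow>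
        E * (1 - 2 * \<alpha> * (w \<bullet> v) - 2 * \<alpha> * (norm v)\<^sup>2 + 2 / 3 * \<alpha>\<^sup>2 * (w \<bullet> v)\<^sup>2)
        \<le> exp (- \<alpha> * (norm (w + v))\<^sup>2)"
      using gaussian_lower_quadratic[OF \<alpha>, of w] unfolding E_def by blast
    define r where "r = min r0 (min (norm w - s) (2 - norm w))"
    have r: "r > 0" using r0 w by (simp add: r_def)
    \<comment> \<open>The Hessian of the quadratic majorant of \<open>\<psi>\<close> at
      \<open>ys\<close> that \<open>gauss\<close> provides: a multiple of the identity minus a
      rank-one term along \<open>w\<close>. The first part bounds the spectrum, the second makes the
      weighted trace negative.\<close>
    define L where "L = (\<lambda>v. (a * E) *\<^sub>R ((4 * \<alpha>) *\<^sub>R v - (4 / 3 * \<alpha>\<^sup>2 * (w \<bullet> v)) *\<^sub>R w))"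
    define p where "p = (2 * a * E * \<alpha>) *\<^sub>R w"
    have linL: "linear L"
      unfolding L_def by (intro linearI) (simp_all add: inner_simps algebra_simps add_divide_distrib)
    have vLv: "v \<bullet> L v = a * E * (4 * \<alpha> * (norm v)\<^sup>2 - 4 / 3 * \<alpha>\<^sup>2 * (w \<bullet> v)\<^sup>2)" for v
      by (simp add: L_def inner_simps power2_norm_eq_inner power2_eq_square[of \<alpha>]
          power2_eq_square[of "v \<bullet> w"] inner_commute[of w] algebra_simps)
    have "upper_test g ys p L"
      unfolding upper_test_def
    proof (intro conjI linL exI[of _ r] r allI impI)
      fix v :: 'a assume v: "norm v < r"
      have "norm (w + v) \<le> norm w + norm v" "norm w - norm v \<le> norm (w + v)"
        using norm_triangle_ineq[of w v] norm_diff_ineq[of w v] by auto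
      then have "ys + v \<in> C" using v by (auto simp: C_def r_def w_def algebra_simps)
      then have "g (ys + v) \<le> g ys + (\<psi> (ys + v) - \<psi> ys)" using mx by fastforce
      also have "\<psi> (ys + v) - \<psi> ys = a * (E - exp (- \<alpha> * (norm (w + v))\<^sup>2))"
        by (simp add: \<psi>_def E_def w_def algebra_simps)
      also have "\<dots> \<le> a * (E - E * (1 - 2 * \<alpha> * (w \<bullet> v) - 2 * \<alpha> * (norm v)\<^sup>2 + 2 / 3 * \<alpha>\<^sup>2 * (w \<bullet> v)\<^sup>2))"
        using gauss[of v] v a by (intro mult_left_mono) (auto simp: r_def)
      also have "\<dots> = p \<bullet> v + (v \<bullet> L v) / 2"
        by (simp add: vLv p_def algebra_simps diff_divide_distrib)
      finally show "g (ys + v) \<le> g ys + p \<bullet> v + (v \<bullet> L v) / 2" by simp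
    qed
    moreover have "v \<bullet> L v \<le> (4 * \<alpha> * a * E) * (norm v)\<^sup>2" for v
    proof -
      have "0 \<le> a * E * (4 / 3 * \<alpha>\<^sup>2 * (w \<bullet> v)\<^sup>2)" using a E by simp
      then show ?thesis unfolding vLv by (simp add: algebra_simps)
    qed
    ultimately have "- \<delta> < 4 * \<alpha> * a * E + \<theta> * (\<Sum>b\<in>Basis. b \<bullet> L b)"
      using tests nys by blast
    also have "(\<Sum>b\<in>Basis. b \<bullet> L b) = a * E * (4 * \<alpha> * d - 4 / 3 * \<alpha>\<^sup>2 * (norm w)\<^sup>2)"
    proof -
      have "(\<Sum>b\<in>Basis. b \<bullet> L b) = (\<Sum>b\<in>Basis. a * E * (4 * \<alpha> - 4 / 3 * \<alpha>\<^sup>2 * (w \<bullet> b)\<^sup>2))"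
        by (intro sum.cong refl) (simp add: vLv)
      also have "\<dots> = a * E * (4 * \<alpha> * d - 4 / 3 * \<alpha>\<^sup>2 * (\<Sum>b\<in>Basis. (w \<bullet> b)\<^sup>2))"
        by (simp add: sum_subtractf sum_distrib_left[symmetric] sum_divide_distrib[symmetric] d_def)
      also have "(\<Sum>b\<in>Basis. (w \<bullet> b)\<^sup>2) = (norm w)\<^sup>2"
        unfolding power2_norm_eq_inner euclidean_inner[of w w] by (simp add: power2_eq_square)
      finally show ?thesis .
    qed
    also have "4 * \<alpha> * a * E + \<theta> * (a * E * (4 * \<alpha> * d - 4 / 3 * \<alpha>\<^sup>2 * (norm w)\<^sup>2))
        = a * E * \<alpha> * (4 + 4 * d * \<theta> - 4 / 3 * \<alpha> * \<theta> * (norm w)\<^sup>2)"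
      by (simp add: power2_eq_square algebra_simps)
    also have "\<dots> \<le> a * E * \<alpha> * (-1)"
    proof -
      have "s\<^sup>2 \<le> (norm w)\<^sup>2" using w s by (intro power_mono) auto
      then have "4 / 3 * \<alpha> * \<theta> * s\<^sup>2 \<le> 4 / 3 * \<alpha> * \<theta> * (norm w)\<^sup>2"
        using \<alpha> \<theta> by (intro mult_left_mono) auto
      then have "4 + 4 * d * \<theta> - 4 / 3 * \<alpha> * \<theta> * (norm w)\<^sup>2 \<le> -1" using \<alpha>e by linarith
      then show ?thesis using a E \<alpha> by (intro mult_left_mono) auto
    qed
    also have "\<dots> \<le> - \<delta>"
    proof -
      have "(norm w)\<^sup>2 \<le> 2\<^sup>2" using w by (intro power_mono) auto
      then have "exp (- 4 * \<alpha>) \<le> E" using \<alpha> by (simp add: E_def)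
      then have "a * \<alpha> * exp (- 4 * \<alpha>) \<le> a * \<alpha> * E" using a \<alpha> by (intro mult_left_mono) auto
      then show ?thesis by (simp add: \<delta>_def algebra_simps)
    qed
    finally show False by simp
  qed
qed

section \<open>Almost second differentiability near a local maximum\<close>

text \<open>This scaling leaves Hessians unchanged, so the test condition of
  \<open>semiconvex_hopf_estimate\<close> is the same at all scales.\<close>

lemma upper_test_rescale:
  assumes "upper_test (\<lambda>x. f (r *\<^sub>R x) / r\<^sup>2) y p L" and r: "r > 0"
  shows "upper_test f (r *\<^sub>R y) (r *\<^sub>R p) L"
proof -
  obtain s where L: "linear L" and s: "s > 0"
    and le: "\<And>w. norm w < s \<Longrightarrow> f (r *\<^sub>R (y + w)) / r\<^sup>2 \<le> f (r *\<^sub>R y) / r\<^sup>2 + p \<bullet> w + (w \<bullet> L w) / 2"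
    using assms unfolding upper_test_def by auto
  show ?thesis
    unfolding upper_test_def
  proof (intro conjI L exI[of _ "r * s"] allI impI)
    show "r * s > 0" using r s by simp
    fix w :: 'a assume "norm w < r * s"
    then have "norm ((1 / r) *\<^sub>R w) < s" using r by (simp add: field_simps)
    from le[OF this] have "f (r *\<^sub>R y + w) / r\<^sup>2
        \<le> f (r *\<^sub>R y) / r\<^sup>2 + (p \<bullet> w) / r + (w \<bullet> L w) / (2 * r\<^sup>2)"
      using r L by (simp add: scaleR_right_distrib linear_scale power2_eq_square)
    then have "f (r *\<^sub>R y + w)
        \<le> (f (r *\<^sub>R y) / r\<^sup>2 + (p \<bullet> w) / r + (w \<bullet> L w) / (2 * r\<^sup>2)) * r\<^sup>2"
      using r by (simp add: pos_divide_le_eq)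
    also have "\<dots> = f (r *\<^sub>R y) + (r *\<^sub>R p) \<bullet> w + (w \<bullet> L w) / 2"
      using r by (simp add: field_simps power2_eq_square)
    finally show "f (r *\<^sub>R y + w) \<le> f (r *\<^sub>R y) + (r *\<^sub>R p) \<bullet> w + (w \<bullet> L w) / 2" .
  qed
qed

lemma upper_test_add_quadratic:
  assumes "upper_test (\<lambda>x. f (z + x) - f z - p \<bullet> x - (x \<bullet> L x) / 2) y q M" and L: "linear L"
  shows "\<exists>p'. upper_test f (z + y) p' (\<lambda>v. L v + M v)"
proof -
  obtain r where M: "linear M" and r: "r > 0"
    and le: "\<And>w. norm w < r \<Longrightarrow>
      f (z + (y + w)) - f z - p \<bullet> (y + w) - ((y + w) \<bullet> L (y + w)) / 2
      \<le> f (z + y) - f z - p \<bullet> y - (y \<bullet> L y) / 2 + q \<bullet> w + (w \<bullet> M w) / 2"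
    using assms unfolding upper_test_def by auto
  \<comment> \<open>The last summand is the gradient of \<open>(x \<bullet> L x) / 2\<close> at
    \<open>y\<close>; the adjoint enters because \<open>L\<close> need not be self-adjoint.\<close>
  define p' where "p' = p + q + (1 / 2) *\<^sub>R (L y + adjoint L y)"
  have "upper_test f (z + y) p' (\<lambda>v. L v + M v)"
    unfolding upper_test_def
  proof (intro conjI exI[of _ r] r allI impI linear_compose_add L M)
    fix w :: 'a assume "norm w < r"
    moreover have "w \<bullet> adjoint L y = y \<bullet> L w"
      by (metis L adjoint_works inner_commute)
    ultimately show "f (z + y + w) \<le> f (z + y) + p' \<bullet> w + (w \<bullet> (L w + M w)) / 2"
      using le[of w] L
      by (simp add: p'_def linear_add inner_simps inner_commute[of _ w] algebra_simps add_divide_distrib)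
  qed
  then show ?thesis by blast
qed

text \<open>The upper and lower quadratic functions share \<open>p\<close> and \<open>L\<close>.
  This two-sided expansion is what later allows increments of \<open>f\<close> in different
  directions to be compared.\<close>

lemma semiconvex_local_max_almost_twice_differentiable:
  fixes f :: "'a::euclidean_space \<Rightarrow> real"
  assumes sc: "semiconvex K f" and K: "K \<ge> 0" and \<rho>: "\<rho> > 0"
    and mx: "\<And>z. norm (z - zh) < \<rho> \<Longrightarrow> f z \<le> f zh"
    and \<epsilon>: "\<epsilon> > 0" and \<eta>: "\<eta> > 0"
  shows "\<exists>z p L r. norm (z - zh) < \<rho> \<and> linear L \<and> r > 0 \<and> (\<forall>v. v \<bullet> L v \<le> \<epsilon> * (norm v)\<^sup>2)
    \<and> (\<forall>w. norm w < r \<longrightarrow> f (z + w) \<le> f z + p \<bullet> w + (w \<bullet> L w) / 2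
        \<and> f z + p \<bullet> w + (w \<bullet> L w) / 2 - \<eta> * (norm w)\<^sup>2 \<le> f (z + w))"
proof -
  define d where "d = real DIM('a)"
  \<comment> \<open>Tests satisfy tr L \<ge> - d K, so \<mu> + \<theta> tr L < \<delta> gives \<mu>
    < \<delta> + \<theta> d K, and both summands are at most \<epsilon>/2.\<close>
  define \<theta> where "\<theta> = \<epsilon> / (2 * (d * K + 1))"
  have d: "d > 0" by (simp add: d_def)
  have dK: "d * K \<ge> 0" using d K by simp
  have \<theta>: "\<theta> > 0" using \<epsilon> dK by (simp add: \<theta>_def)
  \<comment> \<open>The constant is \<open>K + \<epsilon>\<close> because subtracting a quadratic
    function with Hessian at most \<epsilon> costs that much semiconvexity.\<close>
  obtain \<delta>0 where \<delta>0: "\<delta>0 > 0" and hopf: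
    "\<And>(g :: 'a \<Rightarrow> real) y. \<lbrakk>semiconvex (K + \<epsilon>) g; \<forall>y. norm y \<le> 3 \<longrightarrow> g y \<le> 0; g 0 = 0;
      \<forall>y p L \<mu>. norm y \<le> 3 \<longrightarrow> upper_test g y p L \<longrightarrow> (\<forall>v. v \<bullet> L v \<le> \<mu> * (norm v)\<^sup>2)
          \<longrightarrow> - \<delta>0 < \<mu> + \<theta> * (\<Sum>b\<in>Basis. b \<bullet> L b); norm y = 1\<rbrakk> \<Longrightarrow> - \<eta> \<le> g y"
    using semiconvex_hopf_estimate[where 'a='a, of \<eta> "K + \<epsilon>" \<theta>] \<eta> K \<epsilon> \<theta> by force
  define \<delta> where "\<delta> = min \<delta>0 (\<epsilon> / 2)"
  have \<delta>: "\<delta> > 0" "\<delta> \<le> \<delta>0" "\<delta> \<le> \<epsilon> / 2" using \<delta>0 \<epsilon> by (auto simp: \<delta>_def)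
  define V where "V = {\<mu> + \<theta> * (\<Sum>b\<in>Basis. b \<bullet> L b) | \<mu> L z p.
    norm (z - zh) < \<rho> \<and> upper_test f z p L \<and> (\<forall>v. v \<bullet> L v \<le> \<mu> * (norm v)\<^sup>2)}"
  have tr: "- d * K \<le> (\<Sum>b\<in>Basis. b \<bullet> L b)" if "upper_test f z p L" for z p L
  proof -
    have "(\<Sum>b\<in>(Basis::'a set). - K) \<le> (\<Sum>b\<in>Basis. b \<bullet> L b)"
      by (intro sum_mono) (use upper_test_semiconvex_lower_bound[OF sc that] in \<open>metis mult.right_neutral norm_Basis one_power2\<close>)
    then show ?thesis by (simp add: d_def)
  qed
  have "upper_test f zh 0 (\<lambda>v. 0)"
    unfolding upper_test_def using mx \<rho> by (intro conjI exI[of _ \<rho>]) (auto intro: linear_zero)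
  then have V0: "0 \<in> V" unfolding V_def using \<rho> by force
  have "bdd_below V"
  proof (rule bdd_belowI)
    fix x assume "x \<in> V"
    then obtain \<mu> L z p where x: "x = \<mu> + \<theta> * (\<Sum>b\<in>Basis. b \<bullet> L b)" and t: "upper_test f z p L"
      and \<mu>: "\<forall>v. v \<bullet> L v \<le> \<mu> * (norm v)\<^sup>2" unfolding V_def by blast
    obtain b :: 'a where b: "b \<in> Basis" using nonempty_Basis by blast
    have "- K \<le> b \<bullet> L b" using upper_test_semiconvex_lower_bound[OF sc t, of b] b by simp
    also have "\<dots> \<le> \<mu>" using \<mu>[rule_format, of b] b by simp
    finally show "- K + \<theta> * (- d * K) \<le> x"
      unfolding x using \<theta> tr[OF t] by (intro add_mono mult_left_mono) auto
  qed
  then have Inf_le: "Inf V \<le> x" if "x \<in> V" for x using that by (rule cInf_lower[rotated])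
  have "\<exists>x\<in>V. x < Inf V + \<delta>" using V0 \<delta> by (intro cInf_lessD) auto
  then obtain \<mu> L z p where z: "norm (z - zh) < \<rho>" and t: "upper_test f z p L"
      and \<mu>: "\<And>v. v \<bullet> L v \<le> \<mu> * (norm v)\<^sup>2"
      and near: "\<mu> + \<theta> * (\<Sum>b\<in>Basis. b \<bullet> L b) < Inf V + \<delta>" unfolding V_def by blast
  have "\<mu> \<le> \<epsilon>"
  proof -
    have "\<mu> < \<delta> + \<theta> * (d * K)"
      using near Inf_le[OF V0] mult_left_mono[OF tr[OF t], of \<theta>] \<theta> by simp
    also have "\<theta> * (d * K) \<le> \<theta> * (d * K + 1)" using \<theta> by simp
    also have "\<dots> = \<epsilon> / 2" using dK by (simp add: \<theta>_def field_simps)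
    finally show ?thesis using \<delta> by simp
  qed
  have L\<epsilon>: "v \<bullet> L v \<le> \<epsilon> * (norm v)\<^sup>2" for v
    using \<mu>[of v] mult_right_mono[OF \<open>\<mu> \<le> \<epsilon>\<close>, of "(norm v)\<^sup>2"] by simp
  obtain r where L: "linear L" and r: "r > 0"
    and le: "\<And>w. norm w < r \<Longrightarrow> f (z + w) \<le> f z + p \<bullet> w + (w \<bullet> L w) / 2"
    using t unfolding upper_test_def by auto
  define g where "g = (\<lambda>x. f (z + x) - f z - p \<bullet> x - (x \<bullet> L x) / 2)"
  have scg: "semiconvex (K + \<epsilon>) g"
  proof -
    have "semiconvex (K + \<epsilon>) (\<lambda>x. f (z + x) + (- f z - p \<bullet> x - (x \<bullet> L x) / 2))"
      by (intro semiconvex_add semiconvex_translate sc semiconvex_minus_quadratic_form L L\<epsilon>)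
    then show ?thesis by (simp add: g_def algebra_simps)
  qed
  \<comment> \<open>The Hopf estimate at scale |w| involves a ball of radius 3 |w|, which must stay
    where the test is valid and within distance \<open>\<rho>\<close> of \<open>zh\<close>.\<close>
  define r' where "r' = min r (\<rho> - norm (z - zh)) / 4"
  have r': "r' > 0" using r z by (simp add: r'_def)
  have "f z + p \<bullet> w + (w \<bullet> L w) / 2 - \<eta> * (norm w)\<^sup>2 \<le> f (z + w)" if w: "norm w < r'" for w
  proof (cases "w = 0")
    case True then show ?thesis using L by (simp add: linear_0)
  next
    case False
    define s where "s = norm w"
    have s: "s > 0" "3 * s < r" "3 * s < \<rho> - norm (z - zh)"
      using w False r z by (auto simp: s_def r'_def)
    define G where "G = (\<lambda>x. g (s *\<^sub>R x) / s\<^sup>2)"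
    have "- \<eta> \<le> G ((1 / s) *\<^sub>R w)"
    proof (rule hopf)
      show "semiconvex (K + \<epsilon>) G" unfolding G_def by (rule semiconvex_rescale[OF scg s(1)])
      show "G 0 = 0" using L by (simp add: G_def g_def linear_0)
      show "norm ((1 / s) *\<^sub>R w) = 1" using s by (simp add: s_def)
      show "\<forall>y. norm y \<le> 3 \<longrightarrow> G y \<le> 0"
      proof (intro allI impI)
        fix y :: 'a assume "norm y \<le> 3"
        then have "norm (s *\<^sub>R y) \<le> 3 * s" using s by simp
        then have "norm (s *\<^sub>R y) < r" using s by linarith
        from le[OF this] have "g (s *\<^sub>R y) \<le> 0" unfolding g_def by linarith
        then show "G y \<le> 0" by (simp add: G_def divide_nonpos_nonneg)
      qed
      show "\<forall>y p L \<mu>. norm y \<le> 3 \<longrightarrow> upper_test G y p L \<longrightarrow> (\<forall>v. v \<bullet> L v \<le> \<mu> * (norm v)\<^sup>2)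
          \<longrightarrow> - \<delta>0 < \<mu> + \<theta> * (\<Sum>b\<in>Basis. b \<bullet> L b)"
      proof (intro allI impI)
        fix y q :: 'a and M \<nu> assume y: "norm y \<le> 3" and tM: "upper_test G y q M"
          and \<nu>: "\<forall>v. v \<bullet> M v \<le> \<nu> * (norm v)\<^sup>2"
        \<comment> \<open>A test of the rescaled remainder with Hessian \<open>M\<close> and bound
          \<open>\<nu>\<close> combines with the chosen one: L + M and \<mu> + \<nu> compete in
          \<open>V\<close> at z + s y. Near-minimality of the chosen pair bounds \<nu> + \<theta> tr
          M from below.\<close>
        have "upper_test g (s *\<^sub>R y) (s *\<^sub>R q) M"
          using tM s unfolding G_def by (intro upper_test_rescale)
        then obtain p' where p': "upper_test f (z + s *\<^sub>R y) p' (\<lambda>v. L v + M v)"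
          unfolding g_def using upper_test_add_quadratic[OF _ L] by blast
        have "norm (s *\<^sub>R y) \<le> 3 * s" using s y by simp
        then have "norm (z + s *\<^sub>R y - zh) < \<rho>"
          using s(3) norm_triangle_ineq[of "z - zh" "s *\<^sub>R y"] by (simp add: algebra_simps)
        moreover have "\<forall>v. v \<bullet> (L v + M v) \<le> (\<mu> + \<nu>) * (norm v)\<^sup>2"
          using \<mu> \<nu> by (auto simp: inner_simps algebra_simps intro: add_mono)
        ultimately have "(\<mu> + \<nu>) + \<theta> * (\<Sum>b\<in>Basis. b \<bullet> (L b + M b)) \<in> V"
          unfolding V_def using p'
          by (intro CollectI exI[of _ "\<mu> + \<nu>"] exI[of _ "\<lambda>v. L v + M v"] exI[of _ "z + s *\<^sub>R y"]
              exI[of _ p'] conjI refl)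
        then have "Inf V \<le> (\<mu> + \<nu>) + \<theta> * (\<Sum>b\<in>Basis. b \<bullet> (L b + M b))" by (rule Inf_le)
        then have "- \<delta> < \<nu> + \<theta> * (\<Sum>b\<in>Basis. b \<bullet> M b)"
          using near by (simp add: inner_simps sum.distrib algebra_simps)
        then show "- \<delta>0 < \<nu> + \<theta> * (\<Sum>b\<in>Basis. b \<bullet> M b)" using \<delta> by linarith
      qed
    qed
    then have "- \<eta> \<le> g w / s\<^sup>2" using s by (simp add: G_def)
    then have "- \<eta> * s\<^sup>2 \<le> g w" using s by (simp add: pos_le_divide_eq)
    then show ?thesis by (simp add: g_def s_def)
  qed
  moreover have "r' < r" using r z r' by (auto simp: r'_def)
  ultimately show ?thesis
    using z L r' L\<epsilon> le
    by (intro exI[of _ z] exI[of _ p] exI[of _ L] exI[of _ r']) (auto intro: less_trans)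
qed

section \<open>The theorem on sums\<close>

lemma semiconvex_compose_linear:
  fixes f :: "'b::euclidean_space \<Rightarrow> real" and P :: "'a::euclidean_space \<Rightarrow> 'b"
  assumes f: "semiconvex K f" and K: "K \<ge> 0" and P: "linear P" "\<And>x. norm (P x) \<le> norm x"
  shows "semiconvex K (\<lambda>x. f (P x))"
  unfolding semiconvex_def
proof (intro allI impI)
  fix x y :: 'a and t :: real assume t: "0 \<le> t" "t \<le> 1"
  have "f (P ((1 - t) *\<^sub>R x + t *\<^sub>R y))
      \<le> (1 - t) * f (P x) + t * f (P y) + K / 2 * (t * (1 - t)) * (norm (P (x - y)))\<^sup>2"
    using semiconvexD[OF f t, of "P x" "P y"] P(1) by (simp add: linear_add linear_diff linear_scale)
  also have "\<dots> \<le> (1 - t) * f (P x) + t * f (P y) + K / 2 * (t * (1 - t)) * (norm (x - y))\<^sup>2"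
    using t K P(2)[of "x - y"] by (intro add_left_mono mult_left_mono power_mono) auto
  finally show "f (P ((1 - t) *\<^sub>R x + t *\<^sub>R y))
      \<le> (1 - t) * f (P x) + t * f (P y) + K / 2 * (t * (1 - t)) * (norm (x - y))\<^sup>2" .
qed

text \<open>The preceding lemma is applied to the penalised sum on the product space. The Hessian
  bound results from expanding upwards along (w, w), where the penalty is constant, and downwards
  along (w, 0) and (0, w).\<close>

lemma semiconvex_theorem_on_sums:
  fixes S T :: "'a::euclidean_space \<Rightarrow> real"
  assumes S: "semiconvex K S" and T: "semiconvex K T" and K: "K \<ge> 0" and c: "c > 0"
    and mx: "\<And>x y. S x + T y - c / 2 * (norm (x - y))\<^sup>2 \<le> S xh + T yh - c / 2 * (norm (xh - yh))\<^sup>2"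
    and \<epsilon>: "\<epsilon> > 0" and \<rho>: "\<rho> > 0"
  shows "\<exists>x y p1 p2 L1 L2. norm (x - xh) < \<rho> \<and> norm (y - yh) < \<rho>
    \<and> upper_test S x p1 L1 \<and> upper_test T y p2 L2
    \<and> (\<forall>v. v \<bullet> L1 v + v \<bullet> L2 v \<le> \<epsilon> * (norm v)\<^sup>2)"
proof -
  define f where "f = (\<lambda>z::'a \<times> 'a. S (fst z) + T (snd z) - c / 2 * (norm (fst z - snd z))\<^sup>2)"
  define L0 where "L0 = (\<lambda>z::'a \<times> 'a. (c *\<^sub>R (fst z - snd z), c *\<^sub>R (snd z - fst z)))"
  have L0: "linear L0"
    by (rule linearI) (auto simp: L0_def algebra_simps)
  have qL0: "z \<bullet> L0 z = c * (norm (fst z - snd z))\<^sup>2" for z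
    by (simp add: L0_def inner_prod_def power2_norm_eq_inner inner_simps inner_commute algebra_simps)
  have "z \<bullet> L0 z \<le> (2 * c) * (norm z)\<^sup>2" for z
  proof -
    have "(norm (fst z - snd z))\<^sup>2 \<le> 2 * (norm z)\<^sup>2"
      using zero_le_power2[of "norm (fst z + snd z)"]
      by (simp add: power2_norm_eq_inner inner_prod_def inner_simps inner_commute algebra_simps)
    from mult_left_mono[OF this, of c] c show ?thesis unfolding qL0 by simp
  qed
  from semiconvex_minus_quadratic_form[OF L0 this, of 0 0]
  have "semiconvex (2 * c) (\<lambda>z::'a \<times> 'a. - (c / 2 * (norm (fst z - snd z))\<^sup>2))" by (simp add: qL0)
  then have "semiconvex (K + K + 2 * c)
      (\<lambda>z::'a \<times> 'a. S (fst z) + T (snd z) + - (c / 2 * (norm (fst z - snd z))\<^sup>2))"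
    by (intro semiconvex_add semiconvex_compose_linear[OF S K] semiconvex_compose_linear[OF T K]
        linear_fst linear_snd norm_fst_le norm_snd_le)
      (auto simp: norm_fst_le norm_snd_le)
  then have scf: "semiconvex (K + K + 2 * c) f" by (simp add: f_def)
  have K2: "K + K + 2 * c \<ge> 0" using K c by simp
  have mxf: "f z \<le> f (xh, yh)" for z using mx[of "fst z" "snd z"] by (simp add: f_def)
  \<comment> \<open>Budget: \<epsilon>/4 acts on (w, w), whose squared norm is 2 |w|^2, and the two
    lower expansions lose \<epsilon>/8 each. Half the Hessian sum is thus at most \<epsilon>/2 times
    |w|^2.\<close>
  obtain z p L r where z: "norm (z - (xh, yh)) < \<rho>" and L: "linear L" and r: "r > 0"
    and L\<epsilon>: "\<And>v. v \<bullet> L v \<le> \<epsilon> / 4 * (norm v)\<^sup>2"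
    and up: "\<And>w. norm w < r \<Longrightarrow> f (z + w) \<le> f z + p \<bullet> w + (w \<bullet> L w) / 2"
    and low: "\<And>w. norm w < r \<Longrightarrow> f z + p \<bullet> w + (w \<bullet> L w) / 2 - \<epsilon> / 8 * (norm w)\<^sup>2 \<le> f (z + w)"
    using semiconvex_local_max_almost_twice_differentiable[OF scf K2 \<rho> mxf, of "\<epsilon> / 4" "\<epsilon> / 8"] \<epsilon>
    by (metis zero_less_divide_iff zero_less_numeral)
  obtain x y p1 p2 where zp: "z = (x, y)" "p = (p1, p2)" by (metis surj_pair)
  \<comment> \<open>The diagonal blocks of \<open>L\<close>, with the second derivative
    \<open>c\<close> of the penalty in each variable added back.\<close>
  define L1 where "L1 = (\<lambda>v. fst (L (v, 0)) + c *\<^sub>R v)"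
  define L2 where "L2 = (\<lambda>v. snd (L (0, v)) + c *\<^sub>R v)"
  have linL1: "linear L1"
    using linear_add[OF L, of "(_, 0)" "(_, 0)"] linear_scale[OF L, of _ "(_, 0)"]
    by (intro linearI) (simp_all add: L1_def algebra_simps)
  have linL2: "linear L2"
    using linear_add[OF L, of "(0, _)" "(0, _)"] linear_scale[OF L, of _ "(0, _)"]
    by (intro linearI) (simp_all add: L2_def algebra_simps)
  have q1: "v \<bullet> L1 v = (v, 0) \<bullet> L (v, 0) + c * (norm v)\<^sup>2" for v
    by (simp add: L1_def inner_prod_def inner_simps power2_norm_eq_inner)
  have q2: "v \<bullet> L2 v = (0, v) \<bullet> L (0, v) + c * (norm v)\<^sup>2" for v
    by (simp add: L2_def inner_prod_def inner_simps power2_norm_eq_inner)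
  have sq1: "(norm (x + w - y))\<^sup>2 = (norm (x - y))\<^sup>2 + 2 * ((x - y) \<bullet> w) + (norm w)\<^sup>2" for w
    by (simp add: power2_norm_eq_inner inner_simps inner_commute algebra_simps)
  have sq2: "(norm (x - (y + w)))\<^sup>2 = (norm (x - y))\<^sup>2 - 2 * ((x - y) \<bullet> w) + (norm w)\<^sup>2" for w
    by (simp add: power2_norm_eq_inner inner_simps inner_commute algebra_simps)
  have t1: "upper_test S x (p1 + c *\<^sub>R (x - y)) L1"
    unfolding upper_test_def
  proof (intro conjI linL1 exI[of _ r] r allI impI)
    fix w :: 'a assume "norm w < r"
    then have "f (z + (w, 0)) \<le> f z + p \<bullet> (w, 0) + ((w, 0) \<bullet> L (w, 0)) / 2" by (intro up) simp
    then have "S (x + w) \<le> S x + p1 \<bullet> w + ((w, 0) \<bullet> L (w, 0)) / 2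
        + c / 2 * ((norm (x + w - y))\<^sup>2 - (norm (x - y))\<^sup>2)"
      unfolding f_def zp by (simp add: algebra_simps)
    also have "\<dots> = S x + (p1 + c *\<^sub>R (x - y)) \<bullet> w + (w \<bullet> L1 w) / 2"
      unfolding sq1 q1 by (simp add: inner_add_left algebra_simps add_divide_distrib)
    finally show "S (x + w) \<le> S x + (p1 + c *\<^sub>R (x - y)) \<bullet> w + (w \<bullet> L1 w) / 2" .
  qed
  have t2: "upper_test T y (p2 - c *\<^sub>R (x - y)) L2"
    unfolding upper_test_def
  proof (intro conjI linL2 exI[of _ r] r allI impI)
    fix w :: 'a assume "norm w < r"
    then have "f (z + (0, w)) \<le> f z + p \<bullet> (0, w) + ((0, w) \<bullet> L (0, w)) / 2" by (intro up) simp
    then have "T (y + w) \<le> T y + p2 \<bullet> w + ((0, w) \<bullet> L (0, w)) / 2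
        + c / 2 * ((norm (x - (y + w)))\<^sup>2 - (norm (x - y))\<^sup>2)"
      unfolding f_def zp by (simp add: algebra_simps)
    also have "\<dots> = T y + (p2 - c *\<^sub>R (x - y)) \<bullet> w + (w \<bullet> L2 w) / 2"
      unfolding sq2 q2 by (simp add: inner_diff_left algebra_simps add_divide_distrib)
    finally show "T (y + w) \<le> T y + (p2 - c *\<^sub>R (x - y)) \<bullet> w + (w \<bullet> L2 w) / 2" .
  qed
  have "v \<bullet> L1 v + v \<bullet> L2 v \<le> \<epsilon> * (norm v)\<^sup>2" for v
  proof -
    \<comment> \<open>Both sides are homogeneous of degree 2 in \<open>v\<close>, so
      \<open>v\<close> may be shrunk until (w, w) lies in the ball of radius
      \<open>r\<close>.\<close>
    define s where "s = r / (2 * (norm v + 1))"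
    have nv: "norm v + 1 > 0" using norm_ge_zero[of v] by linarith
    have s: "s > 0" using r nv by (simp add: s_def)
    define w where "w = s *\<^sub>R v"
    have "norm w = s * norm v" using s by (simp add: w_def)
    also have "\<dots> < s * (norm v + 1)" using s by simp
    also have "\<dots> = r / 2" using nv unfolding s_def by (simp add: divide_simps)
    finally have w: "norm w < r / 2" .
    have nww: "(norm (w, w))\<^sup>2 = 2 * (norm w)\<^sup>2" by (simp add: power2_norm_eq_inner inner_prod_def)
    also have "\<dots> \<le> (2 * norm w)\<^sup>2" by (simp add: power2_eq_square)
    finally have "norm (w, w) \<le> 2 * norm w" by (rule power2_le_imp_le) simp
    then have "f (z + (w, w)) \<le> f z + p \<bullet> (w, w) + ((w, w) \<bullet> L (w, w)) / 2"
      using w by (intro up) simp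
    also have "(w, w) \<bullet> L (w, w) \<le> \<epsilon> / 2 * (norm w)\<^sup>2" using L\<epsilon>[of "(w, w)"] nww by simp
    finally have 1: "f (z + (w, w)) \<le> f z + p \<bullet> (w, w) + \<epsilon> / 4 * (norm w)\<^sup>2" by simp
    have 2: "f z + p \<bullet> (w, 0) + ((w, 0) \<bullet> L (w, 0)) / 2 - \<epsilon> / 8 * (norm w)\<^sup>2 \<le> f (z + (w, 0))"
      using low[of "(w, 0)"] w r by simp
    have 3: "f z + p \<bullet> (0, w) + ((0, w) \<bullet> L (0, w)) / 2 - \<epsilon> / 8 * (norm w)\<^sup>2 \<le> f (z + (0, w))"
      using low[of "(0, w)"] w r by simp
    \<comment> \<open>The penalty does not change along (w, w); in its two partial increments the
      linear terms cancel and c |w|^2 remains. This matches the \<open>c\<close> added to each of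
      \<open>L1\<close> and \<open>L2\<close>.\<close>
    have 4: "f (z + (w, w)) - f z = (f (z + (w, 0)) - f z) + (f (z + (0, w)) - f z) + c * (norm w)\<^sup>2"
    proof -
      have "f (z + (w, w)) = S (x + w) + T (y + w) - c / 2 * (norm (x - y))\<^sup>2"
        "f (z + (w, 0)) = S (x + w) + T y - c / 2 * (norm (x + w - y))\<^sup>2"
        "f (z + (0, w)) = S x + T (y + w) - c / 2 * (norm (x - (y + w)))\<^sup>2"
        "f z = S x + T y - c / 2 * (norm (x - y))\<^sup>2"
        by (simp_all add: f_def zp)
      then show ?thesis unfolding sq1 sq2 by (simp add: algebra_simps)
    qed
    have 5: "p \<bullet> (w, w) = p \<bullet> (w, 0) + p \<bullet> (0, w)" by (simp add: zp)
    have "w \<bullet> L1 w + w \<bullet> L2 w \<le> \<epsilon> * (norm w)\<^sup>2"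
      unfolding q1 q2 using 1 2 3 4 5 by linarith
    then have "s\<^sup>2 * (v \<bullet> L1 v + v \<bullet> L2 v) \<le> s\<^sup>2 * (\<epsilon> * (norm v)\<^sup>2)"
      using linL1 linL2 by (simp add: w_def linear_scale power2_eq_square algebra_simps)
    then show ?thesis using s by simp
  qed
  moreover have "norm (x - xh) < \<rho>"
    using z norm_fst_le[of "x - xh" "y - yh"] by (simp add: zp)
  moreover have "norm (y - yh) < \<rho>"
    using z norm_snd_le[of "y - yh" "x - xh"] by (simp add: zp)
  ultimately show ?thesis using t1 t2 by blast
qed

section \<open>Upper semicontinuous functions, sup-convolution and doubling\<close>

text \<open>Stated for topological spaces in general because it is also applied on the product
  \<open>C \<times> C\<close>.\<close>

definition upper_semicontinuous_on :: "'a::topological_space set \<Rightarrow> ('a \<Rightarrow> real) \<Rightarrow> bool" where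
  "upper_semicontinuous_on S f \<longleftrightarrow>
     (\<forall>x\<in>S. \<forall>a. f x < a \<longrightarrow> (\<forall>\<^sub>F y in at x within S. f y < a))"

lemma upper_semicontinuous_on_add:
  assumes "upper_semicontinuous_on S f" "upper_semicontinuous_on S g"
  shows "upper_semicontinuous_on S (\<lambda>x. f x + g x)"
  unfolding upper_semicontinuous_on_def
proof (intro ballI allI impI)
  fix x a assume x: "x \<in> S" and a: "f x + g x < a"
  define b where "b = (a - f x - g x) / 2"
  have "\<forall>\<^sub>F y in at x within S. f y < f x + b" "\<forall>\<^sub>F y in at x within S. g y < g x + b"
    using assms x a unfolding upper_semicontinuous_on_def b_def by auto
  then show "\<forall>\<^sub>F y in at x within S. f y + g y < a"
    by eventually_elim (simp add: b_def field_simps)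
qed

lemma continuous_on_imp_upper_semicontinuous_on:
  "continuous_on S f \<Longrightarrow> upper_semicontinuous_on S f"
  unfolding upper_semicontinuous_on_def continuous_on_def by (auto intro: order_tendstoD)

lemma upper_semicontinuous_on_compose:
  assumes f: "upper_semicontinuous_on T f" and g: "continuous_on S g" "g ` S \<subseteq> T"
  shows "upper_semicontinuous_on S (\<lambda>x. f (g x))"
  unfolding upper_semicontinuous_on_def
proof (intro ballI allI impI)
  fix x a assume x: "x \<in> S" and a: "f (g x) < a"
  then have "\<forall>\<^sub>F y in at (g x) within T. f y < a"
    using f g(2) unfolding upper_semicontinuous_on_def by blast
  then obtain N where N: "open N" "g x \<in> N" "\<And>y. y \<in> N \<Longrightarrow> y \<in> T \<Longrightarrow> y \<noteq> g x \<Longrightarrow> f y < a"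
    unfolding eventually_at_topological by blast
  have "(g \<longlongrightarrow> g x) (at x within S)" using g(1) x by (simp add: continuous_on_def)
  then have "\<forall>\<^sub>F y in at x within S. g y \<in> N" using N by (auto dest: topological_tendstoD)
  moreover have "\<forall>\<^sub>F y in at x within S. y \<in> S" by (simp add: eventually_at_topological) blast
  ultimately show "\<forall>\<^sub>F y in at x within S. f (g y) < a"
    by eventually_elim (use N g(2) a in \<open>metis image_subset_iff\<close>)
qed

text \<open>Without a maximum, each \<open>x\<close> has some \<open>m x\<close> of larger value,
  and semicontinuity keeps the values near \<open>x\<close> below \<open>f (m x)\<close>. On a
  finite subcover the largest \<open>f (m x)\<close> would exceed itself.\<close>

lemma upper_semicontinuous_attains_sup:
  assumes S: "compact S" "S \<noteq> {}" and f: "upper_semicontinuous_on S f"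
  shows "\<exists>x\<in>S. \<forall>y\<in>S. f y \<le> f x"
proof (rule ccontr)
  assume "\<not> ?thesis"
  then obtain m where m: "\<And>x. x \<in> S \<Longrightarrow> m x \<in> S \<and> f x < f (m x)" by (metis not_le)
  have "\<exists>N. open N \<and> x \<in> N \<and> (\<forall>y\<in>N \<inter> S. f y < f (m x))" if x: "x \<in> S" for x
  proof -
    have "\<forall>\<^sub>F y in at x within S. f y < f (m x)"
      using f x m unfolding upper_semicontinuous_on_def by blast
    then obtain N where N: "open N" "x \<in> N" "\<And>y. y \<in> N \<Longrightarrow> y \<noteq> x \<Longrightarrow> y \<in> S \<Longrightarrow> f y < f (m x)"
      unfolding eventually_at_topological by blast
    moreover have "f x < f (m x)" using m[OF x] by blast
    ultimately have "\<forall>y\<in>N \<inter> S. f y < f (m x)" by (metis IntE)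
    then show ?thesis using N(1,2) by blast
  qed
  then have "\<forall>x\<in>S. \<exists>N. open N \<and> x \<in> N \<and> (\<forall>y\<in>N \<inter> S. f y < f (m x))" ..
  from bchoice[OF this]
  obtain N where "\<forall>x\<in>S. open (N x) \<and> x \<in> N x \<and> (\<forall>y\<in>N x \<inter> S. f y < f (m x))" ..
  then have N: "open (N x)" "x \<in> N x" "\<And>y. y \<in> N x \<Longrightarrow> y \<in> S \<Longrightarrow> f y < f (m x)" if "x \<in> S" for x
    using that by simp_all
  have "S \<subseteq> (\<Union>x\<in>S. N x)" using N(2) by auto
  then obtain F where F: "F \<subseteq> S" "finite F" "S \<subseteq> (\<Union>x\<in>F. N x)"
    using compactE_image[OF S(1), of S N] N(1) by auto
  have "F \<noteq> {}" using F S by auto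
  then have "Max ((\<lambda>x. f (m x)) ` F) \<in> (\<lambda>x. f (m x)) ` F" using F(2) by (intro Max_in) auto
  then obtain x0 where x0: "x0 \<in> F" "f (m x0) = Max ((\<lambda>x. f (m x)) ` F)" by force
  then obtain x where x: "x \<in> F" "m x0 \<in> N x" using F m by blast
  then have "f (m x0) < f (m x)" using N(3)[of x "m x0"] F(1) m x0(1) by auto
  moreover have "f (m x) \<le> f (m x0)" unfolding x0(2) using F(2) x(1) by (intro Max_ge) auto
  ultimately show False by simp
qed

text \<open>\<open>S\<close> is the sup-convolution of \<open>U\<close>, attained at
  \<open>m x\<close> and finite on the whole space. As a supremum of paraboloids with Hessian -c it
  is semiconvex.\<close>

lemma sup_convolution_exists:
  fixes C :: "'a::euclidean_space set"
  assumes C: "compact C" "C \<noteq> {}" and U: "upper_semicontinuous_on C U"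
  shows "\<exists>S m. semiconvex c S \<and> (\<forall>x. m x \<in> C \<and> S x = U (m x) - c / 2 * (norm (x - m x))\<^sup>2)
    \<and> (\<forall>x. \<forall>y\<in>C. U y - c / 2 * (norm (x - y))\<^sup>2 \<le> S x)"
proof -
  have "\<exists>y\<in>C. \<forall>y'\<in>C. U y' + - (c / 2 * (norm (x - y'))\<^sup>2) \<le> U y + - (c / 2 * (norm (x - y))\<^sup>2)" for x
    by (intro upper_semicontinuous_attains_sup C upper_semicontinuous_on_add U
        continuous_on_imp_upper_semicontinuous_on continuous_intros)
  then obtain m where m: "\<And>x. m x \<in> C"
    "\<And>x y. y \<in> C \<Longrightarrow> U y - c / 2 * (norm (x - y))\<^sup>2 \<le> U (m x) - c / 2 * (norm (x - m x))\<^sup>2"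
    by (simp flip: diff_conv_add_uminus) metis
  define S where "S = (\<lambda>x. U (m x) - c / 2 * (norm (x - m x))\<^sup>2)"
  have "semiconvex c S"
    unfolding semiconvex_def
  proof (intro allI impI)
    fix x y :: 'a and t :: real assume t: "0 \<le> t" "t \<le> 1"
    define z where "z = (1 - t) *\<^sub>R x + t *\<^sub>R y"
    have "z - m z = (1 - t) *\<^sub>R (x - m z) + t *\<^sub>R (y - m z)" by (simp add: z_def algebra_simps)
    then have e: "(norm (z - m z))\<^sup>2
        = (1 - t) * (norm (x - m z))\<^sup>2 + t * (norm (y - m z))\<^sup>2 - t * (1 - t) * (norm (x - y))\<^sup>2"
      by (simp add: norm_convex_combination)
    have "S z = (1 - t) * (U (m z) - c / 2 * (norm (x - m z))\<^sup>2)
        + t * (U (m z) - c / 2 * (norm (y - m z))\<^sup>2) + c / 2 * (t * (1 - t)) * (norm (x - y))\<^sup>2"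
      unfolding S_def e by (simp add: algebra_simps add_divide_distrib diff_divide_distrib)
    also have "\<dots> \<le> (1 - t) * S x + t * S y + c / 2 * (t * (1 - t)) * (norm (x - y))\<^sup>2"
      unfolding S_def using t m by (intro add_right_mono add_mono mult_left_mono) auto
    finally show "S ((1 - t) *\<^sub>R x + t *\<^sub>R y)
        \<le> (1 - t) * S x + t * S y + c / 2 * (t * (1 - t)) * (norm (x - y))\<^sup>2"
      by (simp add: z_def)
  qed
  then show ?thesis using m by (intro exI[of _ S] exI[of _ m]) (auto simp: S_def)
qed

text \<open>The factor 3 relates a penalty c/2 on each of three consecutive segments to a penalty
  c/6 on the whole; equality holds when they trisect a segment.\<close>

lemma norm_diff_le_three_steps:
  fixes a b x y :: "'a::real_normed_vector"
  shows "(norm (a - b))\<^sup>2 \<le> 3 * ((norm (x - a))\<^sup>2 + (norm (x - y))\<^sup>2 + (norm (y - b))\<^sup>2)"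
proof -
  define p q r where "p = norm (x - a)" and "q = norm (x - y)" and "r = norm (y - b)"
  have "norm (a - b) \<le> p + q + r"
    using norm_triangle_ineq[of "a - x" "x - b"] norm_triangle_ineq[of "x - y" "y - b"]
    by (simp add: p_def q_def r_def norm_minus_commute)
  then have "(norm (a - b))\<^sup>2 \<le> (p + q + r)\<^sup>2" by (rule power_mono) simp
  also have "\<dots> \<le> 3 * (p\<^sup>2 + q\<^sup>2 + r\<^sup>2)"
    using zero_le_power2[of "p - q"] zero_le_power2[of "q - r"] zero_le_power2[of "p - r"]
    by (simp add: power2_eq_square algebra_simps)
  finally show ?thesis by (simp add: p_def q_def r_def)
qed

definition upper_test_on :: "'a::euclidean_space set \<Rightarrow> ('a \<Rightarrow> real) \<Rightarrow> 'a \<Rightarrow> 'a \<Rightarrow> ('a \<Rightarrow> 'a) \<Rightarrow> bool" where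
  "upper_test_on C f z p L \<longleftrightarrow> linear L \<and>
     (\<exists>r>0. \<forall>w. norm w < r \<longrightarrow> z + w \<in> C \<longrightarrow> f (z + w) \<le> f z + p \<bullet> w + (w \<bullet> L w) / 2)"

text \<open>The point m + w competes at x + w with the same displacement x - m. A test function for
  \<open>S\<close> at \<open>x\<close>, translated to the contact point \<open>m\<close>, therefore
  tests \<open>U\<close>.\<close>

lemma upper_test_sup_convolution:
  assumes "upper_test S x p L" and "S x = U m - c / 2 * (norm (x - m))\<^sup>2"
    and "\<And>x y. y \<in> C \<Longrightarrow> U y - c / 2 * (norm (x - y))\<^sup>2 \<le> S x"
  shows "upper_test_on C U m p L"
proof -
  obtain r where r: "r > 0" and L: "linear L"
    and le: "\<And>w. norm w < r \<Longrightarrow> S (x + w) \<le> S x + p \<bullet> w + (w \<bullet> L w) / 2"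
    using assms(1) unfolding upper_test_def by auto
  show ?thesis
    unfolding upper_test_on_def
  proof (intro conjI L exI[of _ r] r allI impI)
    fix w assume w: "norm w < r" "m + w \<in> C"
    have "U (m + w) - c / 2 * (norm (x - m))\<^sup>2 \<le> S (x + w)"
      using assms(3)[OF w(2), of "x + w"] by simp
    then show "U (m + w) \<le> U m + p \<bullet> w + (w \<bullet> L w) / 2"
      using le[OF w(1)] assms(2) by linarith
  qed
qed

text \<open>Sup-convolution makes both functions semiconvex, so that
  \<open>semiconvex_theorem_on_sums\<close> applies; its tests are carried back to the contact
  points. The loss \<open>\<epsilon>'\<close> is the price of leaving the exact maximum
  point.\<close>

lemma doubling_theorem_on_sums:
  fixes C :: "'a::euclidean_space set"
  assumes C: "compact C" and U: "upper_semicontinuous_on C U" and V: "upper_semicontinuous_on C V"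
    and x1: "x1 \<in> C" and c: "c > 0" and \<epsilon>: "\<epsilon> > 0" and \<epsilon>': "\<epsilon>' > 0"
  shows "\<exists>x\<in>C. \<exists>y\<in>C. \<exists>p1 p2 L1 L2. U x1 + V x1 - \<epsilon>' \<le> U x + V y - c / 6 * (norm (x - y))\<^sup>2
    \<and> upper_test_on C U x p1 L1 \<and> upper_test_on C V y p2 L2
    \<and> (\<forall>v. v \<bullet> L1 v + v \<bullet> L2 v \<le> \<epsilon> * (norm v)\<^sup>2)"
proof -
  have ne: "C \<noteq> {}" using x1 by blast
  obtain S m where S: "semiconvex c S" and m: "\<And>x. m x \<in> C"
      and Sm: "\<And>x. S x = U (m x) - c / 2 * (norm (x - m x))\<^sup>2"
      and Sge: "\<And>x y. y \<in> C \<Longrightarrow> U y - c / 2 * (norm (x - y))\<^sup>2 \<le> S x"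
    using sup_convolution_exists[OF C ne U, of c] by blast
  obtain T n where T: "semiconvex c T" and n: "\<And>x. n x \<in> C"
      and Tn: "\<And>x. T x = V (n x) - c / 2 * (norm (x - n x))\<^sup>2"
      and Tge: "\<And>x y. y \<in> C \<Longrightarrow> V y - c / 2 * (norm (x - y))\<^sup>2 \<le> T x"
    using sup_convolution_exists[OF C ne V, of c] by blast
  have "\<exists>z\<in>C \<times> C. \<forall>z'\<in>C \<times> C. U (fst z') + V (snd z') + - (c / 6 * (norm (fst z' - snd z'))\<^sup>2)
      \<le> U (fst z) + V (snd z) + - (c / 6 * (norm (fst z - snd z))\<^sup>2)"
    by (intro upper_semicontinuous_attains_sup compact_Times C upper_semicontinuous_on_add
        upper_semicontinuous_on_compose[OF U] upper_semicontinuous_on_compose[OF V]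
        continuous_on_imp_upper_semicontinuous_on continuous_intros) (use ne in auto)
  then obtain a b where a: "a \<in> C" and b: "b \<in> C"
    and ab: "\<And>x y. x \<in> C \<Longrightarrow> y \<in> C \<Longrightarrow>
      U x + V y - c / 6 * (norm (x - y))\<^sup>2 \<le> U a + V b - c / 6 * (norm (a - b))\<^sup>2" by force
  \<comment> \<open>\<open>xh\<close> and \<open>yh\<close> trisect the segment from
    \<open>a\<close> to \<open>b\<close>, the equality case of
    \<open>norm_diff_le_three_steps\<close>. Hence (xh, yh) maximises the sup-convolutions with
    penalty c/2 because (a, b) maximises the original sum with penalty c/6.\<close>
  define xh where "xh = a + (1 / 3) *\<^sub>R (b - a)"
  define yh where "yh = b + (1 / 3) *\<^sub>R (a - b)"
  have "(1 - 1 / 3 - 1 / 3) *\<^sub>R (a - b) = (a - b) - (1 / 3) *\<^sub>R (a - b) - (1 / 3) *\<^sub>R (a - b)"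
    by (simp only: scaleR_left_diff_distrib scaleR_one)
  then have "xh - yh = (1 / 3) *\<^sub>R (a - b)" by (simp add: xh_def yh_def algebra_simps)
  moreover have "xh - a = (1 / 3) *\<^sub>R (b - a)" "yh - b = (1 / 3) *\<^sub>R (a - b)"
    by (simp_all add: xh_def yh_def)
  ultimately have nh: "norm (xh - a) = norm (a - b) / 3" "norm (yh - b) = norm (a - b) / 3"
      "norm (xh - yh) = norm (a - b) / 3"
    by (simp_all add: norm_minus_commute)
  have le: "S x + T y - c / 2 * (norm (x - y))\<^sup>2
      \<le> U (m x) + V (n y) - c / 6 * (norm (m x - n y))\<^sup>2" for x y
  proof -
    have "c / 6 * (norm (m x - n y))\<^sup>2
        \<le> c / 6 * (3 * ((norm (x - m x))\<^sup>2 + (norm (x - y))\<^sup>2 + (norm (y - n y))\<^sup>2))"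
      using c by (intro mult_left_mono norm_diff_le_three_steps) auto
    then show ?thesis unfolding Sm Tn by (simp add: algebra_simps)
  qed
  have ge: "U a + V b - c / 6 * (norm (a - b))\<^sup>2 \<le> S xh + T yh - c / 2 * (norm (xh - yh))\<^sup>2"
    using Sge[OF a, of xh] Tge[OF b, of yh] unfolding nh by (simp add: power_divide algebra_simps)
  have mx: "S x + T y - c / 2 * (norm (x - y))\<^sup>2 \<le> S xh + T yh - c / 2 * (norm (xh - yh))\<^sup>2" for x y
    using le[of x y] ab[OF m n, of x y] ge by linarith
  \<comment> \<open>Continuity keeps the penalised value at the perturbed point within
    \<open>\<epsilon>'\<close> of the maximum.\<close>
  define f where "f = (\<lambda>z. S (fst z) + T (snd z) - c / 2 * (norm (fst z - snd z))\<^sup>2)"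
  have "continuous_on UNIV f"
    unfolding f_def
    by (intro continuous_intros continuous_on_compose2[OF semiconvex_continuous_on[OF S, of UNIV]]
        continuous_on_compose2[OF semiconvex_continuous_on[OF T, of UNIV]]) auto
  then obtain \<rho> where \<rho>: "\<rho> > 0" and near: "\<And>z. dist z (xh, yh) < \<rho> \<Longrightarrow> dist (f z) (f (xh, yh)) < \<epsilon>'"
    using \<epsilon>' unfolding continuous_on_iff by (metis UNIV_I)
  obtain x y p1 p2 L1 L2 where xy: "norm (x - xh) < \<rho> / 2" "norm (y - yh) < \<rho> / 2"
    and t: "upper_test S x p1 L1" "upper_test T y p2 L2"
    and L: "\<forall>v. v \<bullet> L1 v + v \<bullet> L2 v \<le> \<epsilon> * (norm v)\<^sup>2"
    using semiconvex_theorem_on_sums[OF S T less_imp_le[OF c] c mx \<epsilon>, of "\<rho> / 2"] \<rho> by auto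
  have "dist (x, y) (xh, yh) \<le> norm (x - xh) + norm (y - yh)"
    by (simp add: dist_norm norm_Pair sqrt_sum_squares_le_sum)
  then have "dist (f (x, y)) (f (xh, yh)) < \<epsilon>'" using xy by (intro near) linarith
  then have "f (xh, yh) - \<epsilon>' \<le> f (x, y)" by (simp add: dist_real_def)
  then have "U x1 + V x1 - \<epsilon>' \<le> U (m x) + V (n y) - c / 6 * (norm (m x - n y))\<^sup>2"
    using le[of x y] ge ab[OF x1 x1] unfolding f_def by simp
  moreover have "upper_test_on C U (m x) p1 L1" by (rule upper_test_sup_convolution[OF t(1) Sm Sge])
  moreover have "upper_test_on C V (n y) p2 L2" by (rule upper_test_sup_convolution[OF t(2) Tn Tge])
  ultimately show ?thesis using m n L by blast
qed

section \<open>The phase operator\<close>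

lemma arctan_diff_le:
  fixes x c :: real assumes "c \<ge> 0" shows "arctan (x + c) \<le> arctan x + c"
proof -
  have "\<exists>D. ((\<lambda>t. t - arctan t) has_real_derivative D) (at t) \<and> 0 \<le> D" for t :: real
    by (rule exI[of _ "1 - inverse (1 + t\<^sup>2)"])
      (auto intro!: derivative_eq_intros simp: inverse_le_1_iff)
  then have "x - arctan x \<le> (x + c) - arctan (x + c)"
    using assms by (intro DERIV_nonneg_imp_nondecreasing[where f="\<lambda>t. t - arctan t"]) auto
  then show ?thesis by simp
qed

lemma Gop_shift_le:
  fixes A :: "real^'n^'n"
  assumes "A \<in> SymM" "c \<ge> 0"
  shows "Gop (A + c *\<^sub>R mat 1) \<le> Gop A + real CARD('n) * c"
proof -
  obtain q d where d: "eigensystem A q d" using symmetric_eigensystem_exists[OF assms(1)] .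
  have "(\<Sum>i\<in>UNIV. arctan (d i + c)) \<le> (\<Sum>i\<in>UNIV. arctan (d i) + c)"
    using assms(2) by (intro sum_mono arctan_diff_le)
  then show ?thesis
    unfolding eigensystem_Gop[OF d] eigensystem_Gop[OF eigensystem_shift[OF d]] by (simp add: sum.distrib)
qed

lemma norm_matrix_vector_mult_le:
  fixes A :: "real^'n^'m" shows "norm (A *v x) \<le> norm A * norm x"
proof -
  have "norm (A *v x) \<le> L2_set (\<lambda>i. norm (A $ i) * norm x) UNIV"
    unfolding norm_vec_def[of "A *v x"]
  proof (rule L2_set_mono)
    fix i show "norm ((A *v x) $ i) \<le> norm (A $ i) * norm x"
      using Cauchy_Schwarz_ineq2[of "A $ i" x] by (simp add: matrix_vector_mult_def inner_vec_def)
  qed simp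
  also have "\<dots> = norm A * norm x"
    by (simp add: L2_set_left_distrib norm_vec_def[of A])
  finally show ?thesis .
qed

lemma psd_le_shift_norm:
  fixes A B :: "real^'n^'n" shows "psd_le A (B + norm (A - B) *\<^sub>R mat 1)"
  unfolding psd_le_def
proof
  fix x :: "real^'n"
  have "x \<bullet> ((A - B) *v x) \<le> norm x * (norm (A - B) * norm x)"
    using norm_cauchy_schwarz[of x "(A - B) *v x"] norm_matrix_vector_mult_le[of "A - B" x]
    by (meson mult_left_mono norm_ge_zero order_trans)
  also have "\<dots> = norm (A - B) * (x \<bullet> x)" by (simp add: power2_norm_eq_inner[symmetric] power2_eq_square)
  finally show "0 \<le> x \<bullet> ((B + norm (A - B) *\<^sub>R mat 1 - A) *v x)"
    by (simp add: matrix_vector_mult_diff_rdistrib matrix_vector_mult_add_rdistrib inner_simps)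
qed

text \<open>Since A \<le> B + |A - B| I, monotonicity and the bound for shifts by multiples of the
  identity give one half; the other follows by exchanging the matrices.\<close>

lemma Gop_lipschitz:
  fixes A B :: "real^'n^'n"
  assumes "A \<in> SymM" "B \<in> SymM"
  shows "\<bar>Gop A - Gop B\<bar> \<le> real CARD('n) * norm (A - B)"
proof -
  have "Gop A \<le> Gop B + real CARD('n) * norm (A - B)" if "A \<in> SymM" "B \<in> SymM" for A B :: "real^'n^'n"
    using Gop_mono[OF that(1) SymM_shift[OF that(2)] psd_le_shift_norm]
      Gop_shift_le[OF that(2), of "norm (A - B)"] by simp
  from this[OF assms] this[OF assms(2,1)] show ?thesis by (simp add: norm_minus_commute)
qed

lemma continuous_on_Gop: "continuous_on SymM (Gop :: real^'n^'n \<Rightarrow> real)"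
proof -
  have "(real CARD('n))-lipschitz_on SymM (Gop :: real^'n^'n \<Rightarrow> real)"
    by (rule lipschitz_onI) (use Gop_lipschitz in \<open>auto simp: dist_norm\<close>)
  then show ?thesis by (rule lipschitz_on_continuous_on)
qed

lemma closed_SymM: "closed (SymM :: (real^'n^'n) set)"
proof -
  have "SymM = {A :: real^'n^'n. \<forall>i j. A $ j $ i = A $ i $ j}"
    by (auto simp: SymM_def transpose_def vec_eq_iff)
  moreover have "closed {A :: real^'n^'n. \<forall>i j. A $ j $ i = A $ i $ j}"
    by (intro closed_Collect_all closed_Collect_eq continuous_intros)
  ultimately show ?thesis by simp
qed

lemma Gop_scaled_identity: "Gop (c *\<^sub>R mat 1 :: real^'n^'n) = real CARD('n) * arctan c"
  using eigensystem_Gop[OF eigensystem_scaled_identity[where 'n='n, of c]] by simp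

lemma scaled_identity_SymM: "c *\<^sub>R mat 1 \<in> SymM"
  using SymM_shift[of 0 c] by (simp add: SymM_def transpose_def vec_eq_iff)

text \<open>If all eigenvalues of a matrix are large in modulus, then its phase is close to one of the
  special values \<open>(N - 2j) \<pi> / 2\<close>. Away from these values some eigenvalue stays in a fixed
  compact interval, on which the arctangent has a definite increment.\<close>

lemma Gop_uniform_gain:
  fixes a \<eta> :: real
  assumes a: "(real CARD('n) - 2 * real k) * pi / 2 < a"
      "a < (real CARD('n) - 2 * (real k - 1)) * pi / 2" and \<eta>: "\<eta> > 0"
  shows "\<exists>c>0. \<forall>A\<in>(SymM :: (real^'n^'n) set). a - c \<le> Gop A \<longrightarrow> a + c \<le> Gop (A + \<eta> *\<^sub>R mat 1)"
proof -
  define n where "n = real CARD('n)"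
  have n: "n > 0" by (simp add: n_def)
  \<comment> \<open>The distance from \<open>a\<close> to the ends of its interval. No special value
    lies inside the interval, so all of them are at least this far from \<open>a\<close>.\<close>
  define \<epsilon> where "\<epsilon> = min (a - (n - 2 * real k) * pi / 2) ((n - 2 * (real k - 1)) * pi / 2 - a)"
  have \<epsilon>: "\<epsilon> > 0" using a by (simp add: \<epsilon>_def n_def)
  have special: "\<epsilon> \<le> \<bar>a - (n - 2 * real j) * pi / 2\<bar>" for j :: nat
  proof (cases "j \<ge> k")
    case True
    then have "(n - 2 * real j) * (pi / 2) \<le> (n - 2 * real k) * (pi / 2)" by (intro mult_right_mono) auto
    moreover have "\<epsilon> \<le> a - (n - 2 * real k) * pi / 2" by (simp add: \<epsilon>_def)
    ultimately show ?thesis by linarith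
  next
    case False
    then have "(n - 2 * (real k - 1)) * (pi / 2) \<le> (n - 2 * real j) * (pi / 2)"
      by (intro mult_right_mono) auto
    moreover have "\<epsilon> \<le> (n - 2 * (real k - 1)) * pi / 2 - a" by (simp add: \<epsilon>_def)
    ultimately show ?thesis by linarith
  qed
  \<comment> \<open>Eigenvalues of large modulus have arctangents within \<epsilon>/(4n) of a half
    multiple of pi, so that n of them err by at most \<epsilon>/4.\<close>
  have "\<forall>\<^sub>F t in at_top. arctan t > pi / 2 - \<epsilon> / (4 * n)"
    using \<epsilon> n by (intro order_tendstoD(1)[OF tendsto_arctan_at_top]) simp
  then obtain M0 where M0: "\<And>t. t \<ge> M0 \<Longrightarrow> arctan t > pi / 2 - \<epsilon> / (4 * n)"
    unfolding eventually_at_top_linorder by blast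
  define M where "M = max M0 1"
  have M: "M \<ge> 1" "\<And>t. t \<ge> M \<Longrightarrow> arctan t > pi / 2 - \<epsilon> / (4 * n)" using M0 by (auto simp: M_def)
  have "\<exists>t\<in>{-M..M}. \<forall>s\<in>{-M..M}. arctan (t + \<eta>) - arctan t \<le> arctan (s + \<eta>) - arctan s"
    using M by (intro continuous_attains_inf continuous_intros) auto
  then obtain t where t: "\<And>s. \<bar>s\<bar> \<le> M \<Longrightarrow> arctan (t + \<eta>) - arctan t \<le> arctan (s + \<eta>) - arctan s"
    by (metis abs_le_iff atLeastAtMost_iff minus_le_iff)
  define g where "g = arctan (t + \<eta>) - arctan t"
  have g: "g > 0" using \<eta> by (simp add: g_def arctan_less_iff)
  \<comment> \<open>With an eigenvalue in [-M, M] the shift gains g \<ge> 2 c. Otherwise the phase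
    is within \<epsilon>/4 of a special value; being at least a - \<epsilon>/2, it is at least a + 3
    \<epsilon>/4 even before the shift.\<close>
  define c where "c = min (g / 2) (\<epsilon> / 2)"
  have c: "c > 0" "2 * c \<le> g" "2 * c \<le> \<epsilon>" using g \<epsilon> by (auto simp: c_def)
  show ?thesis
  proof (intro exI[of _ c] conjI c ballI impI)
    fix A :: "real^'n^'n" assume A: "A \<in> SymM" and GA: "a - c \<le> Gop A"
    obtain q d where d: "eigensystem A q d" using symmetric_eigensystem_exists[OF A] .
    have G1: "Gop (A + \<eta> *\<^sub>R mat 1) = (\<Sum>i\<in>UNIV. arctan (d i + \<eta>))"
      by (rule eigensystem_Gop[OF eigensystem_shift[OF d]])
    have mono: "arctan (d i) \<le> arctan (d i + \<eta>)" for i using \<eta> by (simp add: arctan_le_iff)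
    show "a + c \<le> Gop (A + \<eta> *\<^sub>R mat 1)"
    proof (cases "\<exists>i. \<bar>d i\<bar> \<le> M")
      case True
      then obtain i where i: "\<bar>d i\<bar> \<le> M" by blast
      have "g \<le> (arctan (d i + \<eta>) - arctan (d i))" using t[OF i] by (simp add: g_def)
      also have "\<dots> \<le> (\<Sum>i\<in>UNIV. arctan (d i + \<eta>) - arctan (d i))"
        using mono by (intro member_le_sum) auto
      finally have "g \<le> Gop (A + \<eta> *\<^sub>R mat 1) - Gop A"
        by (simp add: G1 eigensystem_Gop[OF d] sum_subtractf)
      then show ?thesis using GA c by linarith
    next
      case False
      define s where "s = (\<lambda>i. if d i < 0 then - (pi / 2) else pi / 2)"
      have "\<bar>arctan (d i) - s i\<bar> \<le> \<epsilon> / (4 * n)" for i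
      proof (cases "d i < 0")
        case True
        then have "- d i \<ge> M" using False by (metis abs_of_neg linear)
        from M(2)[OF this] show ?thesis
          using True arctan_lbound[of "d i"] by (simp add: s_def arctan_minus)
      next
        case nn: False
        then have "d i \<ge> M" using False by (metis abs_of_nonneg linear not_less)
        from M(2)[OF this] show ?thesis
          using nn arctan_ubound[of "d i"] by (simp add: s_def)
      qed
      then have "(\<Sum>i\<in>UNIV. \<bar>arctan (d i) - s i\<bar>) \<le> (\<Sum>i\<in>(UNIV::'n set). \<epsilon> / (4 * n))"
        by (rule sum_mono)
      then have "\<bar>\<Sum>i\<in>UNIV. arctan (d i) - s i\<bar> \<le> n * (\<epsilon> / (4 * n))"
        by (intro order_trans[OF sum_abs]) (simp add: n_def)
      then have "\<bar>Gop A - sum s UNIV\<bar> \<le> \<epsilon> / 4"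
        using n by (simp add: eigensystem_Gop[OF d] sum_subtractf)
      moreover have "sum s UNIV = (n - 2 * real (card {i. d i < 0})) * pi / 2"
      proof -
        have "s = (\<lambda>i. pi / 2 - (if d i < 0 then pi else 0))" by (auto simp: s_def)
        then have "sum s UNIV = n * (pi / 2) - real (card {i. d i < 0}) * pi"
          by (simp add: sum_subtractf n_def sum.If_cases)
        then show ?thesis by (simp add: algebra_simps)
      qed
      ultimately have "a + c \<le> Gop A"
        using special[of "card {i. d i < 0}"] GA c \<epsilon> by linarith
      also have "\<dots> \<le> Gop (A + \<eta> *\<^sub>R mat 1)"
        unfolding G1 eigensystem_Gop[OF d] using mono by (intro sum_mono)
      finally show ?thesis .
    qed
  qed
qed

lemma pnorm_scaled_identity:
  "pnorm (0, c *\<^sub>R mat 1 :: real^'n^'n) = \<bar>c\<bar>"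
proof -
  have "{\<bar>lam (c *\<^sub>R mat 1 :: real^'n^'n) i\<bar> | i. i \<in> {1..CARD('n)}} = {\<bar>c\<bar>}"
    using lam_scaled_identity[where 'n='n, of _ c] by (auto intro!: exI[of _ 1])
  then show ?thesis by (simp add: pnorm_def)
qed

section \<open>From quadratic test functions to viscosity jets\<close>

text \<open>The ordering arguments for \<open>Gop\<close> concern symmetric matrices, whereas test
  operators are only linear; the symmetric part has the same quadratic form.\<close>

lemma symmetric_matrix_of_quadratic_form:
  fixes L :: "real^'n \<Rightarrow> real^'n"
  assumes "linear L"
  obtains A where "A \<in> SymM" "\<And>v. v \<bullet> (A *v v) = v \<bullet> L v"
proof -
  define A where "A = (1 / 2) *\<^sub>R (matrix L + transpose (matrix L))"
  have "transpose A = A" by (simp add: A_def transpose_def vec_eq_iff)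
  moreover have "v \<bullet> (A *v v) = v \<bullet> L v" for v
  proof -
    have "v \<bullet> (transpose (matrix L) *v v) = v \<bullet> (matrix L *v v)"
      by (metis dot_lmul_matrix inner_commute transpose_matrix_vector)
    then show ?thesis
      using assms
      by (simp add: A_def scaleR_matrix_vector_assoc[symmetric] matrix_vector_mult_add_rdistrib
          inner_simps matrix_works linear_matrix_vector_mul_eq)
  qed
  ultimately show ?thesis using that by (auto simp: SymM_def)
qed

lemma C2_hess_quadratic:
  fixes A :: "real^'n^'n"
  assumes A: "A \<in> SymM"
  shows "C2_hess (\<lambda>x. c + p \<bullet> (x - x0) + ((x - x0) \<bullet> (A *v (x - x0))) / 2) x0 A"
  unfolding C2_hess_def
proof (intro exI[of _ 1] conjI exI[of _ "\<lambda>x. p + A *v (x - x0)"] exI[of _ "\<lambda>x. A"] ballI)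
  fix x :: "real^'n"
  have lin: "((\<lambda>x. A *v (x - x0)) has_derivative (\<lambda>v. A *v v)) (at x)"
    by (rule has_derivative_eq_rhs[OF bounded_linear.has_derivative[OF matrix_vector_mul_bounded_linear]])
      (auto intro!: derivative_eq_intros)
  then show "((\<lambda>x. p + A *v (x - x0)) has_derivative (\<lambda>v. A *v v)) (at x)"
    by (auto intro!: derivative_eq_intros)
  have sym: "y \<bullet> (A *v z) = z \<bullet> (A *v y)" for y z by (metis SymM_inner[OF A] inner_commute)
  show "((\<lambda>x. c + p \<bullet> (x - x0) + ((x - x0) \<bullet> (A *v (x - x0))) / 2)
      has_derivative (\<lambda>v. (p + A *v (x - x0)) \<bullet> v)) (at x)"
  proof (rule has_derivative_eq_rhs)
    show "((\<lambda>x. c + p \<bullet> (x - x0) + ((x - x0) \<bullet> (A *v (x - x0))) / 2)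
        has_derivative (\<lambda>v. p \<bullet> v + ((x - x0) \<bullet> (A *v v) + v \<bullet> (A *v (x - x0))) / 2)) (at x)"
      by (auto intro!: derivative_eq_intros lin)
    show "(\<lambda>v. p \<bullet> v + ((x - x0) \<bullet> (A *v v) + v \<bullet> (A *v (x - x0))) / 2)
        = (\<lambda>v. (p + A *v (x - x0)) \<bullet> v)"
    proof
      fix v show "p \<bullet> v + ((x - x0) \<bullet> (A *v v) + v \<bullet> (A *v (x - x0))) / 2 = (p + A *v (x - x0)) \<bullet> v"
        unfolding sym[of "x - x0" v] by (simp add: inner_add_left inner_commute[of v])
    qed
  qed
qed auto

lemma Jplus_quadratic:
  fixes A :: "real^'n^'n"
  assumes "A \<in> SymM" "r > 0"
    and "\<And>w. norm w < r \<Longrightarrow> x0 + w \<in> \<Omega> \<Longrightarrow> u (x0 + w) \<le> u x0 + p \<bullet> w + (w \<bullet> (A *v w)) / 2"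
  shows "(u x0, A) \<in> Jplus \<Omega> u x0"
  unfolding Jplus_def
proof (intro CollectI exI conjI)
  let ?\<phi> = "\<lambda>x. u x0 + p \<bullet> (x - x0) + ((x - x0) \<bullet> (A *v (x - x0))) / 2"
  show "C2_hess ?\<phi> x0 A" by (rule C2_hess_quadratic[OF assms(1)])
  show "\<forall>x\<in>ball x0 r \<inter> \<Omega>. u x \<le> ?\<phi> x"
  proof
    fix x assume "x \<in> ball x0 r \<inter> \<Omega>"
    then show "u x \<le> ?\<phi> x" using assms(3)[of "x - x0"] by (simp add: dist_norm norm_minus_commute)
  qed
qed (use assms(2) in auto)

lemma Jminus_quadratic:
  fixes A :: "real^'n^'n"
  assumes "A \<in> SymM" "r > 0"
    and "\<And>w. norm w < r \<Longrightarrow> x0 + w \<in> \<Omega> \<Longrightarrow> u x0 + p \<bullet> w + (w \<bullet> (A *v w)) / 2 \<le> u (x0 + w)"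
  shows "(u x0, A) \<in> Jminus \<Omega> u x0"
  unfolding Jminus_def
proof (intro CollectI exI conjI)
  let ?\<phi> = "\<lambda>x. u x0 + p \<bullet> (x - x0) + ((x - x0) \<bullet> (A *v (x - x0))) / 2"
  show "C2_hess ?\<phi> x0 A" by (rule C2_hess_quadratic[OF assms(1)])
  show "\<forall>x\<in>ball x0 r \<inter> \<Omega>. ?\<phi> x \<le> u x"
  proof
    fix x assume "x \<in> ball x0 r \<inter> \<Omega>"
    then show "?\<phi> x \<le> u x" using assms(3)[of "x - x0"] by (simp add: dist_norm norm_minus_commute)
  qed
qed (use assms(2) in auto)

lemma usc_on_imp_upper_semicontinuous_on:
  assumes "usc_on S u" shows "upper_semicontinuous_on S u"
  unfolding upper_semicontinuous_on_def eventually_at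
proof (intro ballI allI impI)
  fix x a assume "x \<in> S" "u x < a"
  then obtain e where "e > 0" "\<forall>y\<in>S. dist y x < e \<longrightarrow> u y < a"
    using assms unfolding usc_on_def by blast
  then show "\<exists>d>0. \<forall>y\<in>S. y \<noteq> x \<and> dist y x < d \<longrightarrow> u y < a" by (intro exI[of _ e]) simp
qed

lemma lsc_on_imp_usc_on_minus:
  assumes "lsc_on S v" shows "usc_on S (\<lambda>x. - v x)"
  unfolding usc_on_def
proof (intro ballI allI impI)
  fix x a assume "x \<in> S" "- v x < a"
  then have "- a < v x" by simp
  then obtain e where "e > 0" "\<forall>y\<in>S. dist y x < e \<longrightarrow> - a < v y"
    using assms \<open>x \<in> S\<close> unfolding lsc_on_def by blast
  then show "\<exists>e>0. \<forall>y\<in>S. dist y x < e \<longrightarrow> - v y < a"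
    by (intro exI[of _ e]) (auto simp: minus_less_iff)
qed

section \<open>The comparison principle\<close>

text \<open>Doubling of variables for \<open>u\<close> plus a small quadratic function and for
  \<open>- v\<close>. The assumption \<open>gain\<close> is the conclusion of
  \<open>Gop_uniform_gain\<close> at the values of \<open>h\<close>: it turns surplus in the
  Hessians into an inequality that survives the variation of \<open>h\<close> between the two
  contact points.\<close>

lemma viscosity_comparison:
  fixes \<Omega> :: "(real^'n) set" and h :: "real^'n \<Rightarrow> real"
  assumes bdd: "bounded \<Omega>" and op: "open \<Omega>" and hc: "continuous_on \<Omega> h"
    and gain: "\<And>x \<eta>. x \<in> \<Omega> \<Longrightarrow> \<eta> > 0 \<Longrightarrow>
      \<exists>c>0. \<forall>A\<in>(SymM :: (real^'n^'n) set). h x - c \<le> Gop A \<longrightarrow> h x + c \<le> Gop (A + \<eta> *\<^sub>R mat 1)"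
    and u: "usc_on (closure \<Omega>) u" "visc_sub \<Omega> h u"
    and v: "lsc_on (closure \<Omega>) v" "visc_super \<Omega> h v"
    and bd: "\<forall>x\<in>frontier \<Omega>. u x \<le> v x"
    and x0: "x0 \<in> \<Omega>"
  shows "u x0 \<le> v x0"
proof (rule ccontr)
  assume "\<not> u x0 \<le> v x0"
  define C where "C = closure \<Omega>"
  have C: "compact C" using bdd by (simp add: C_def compact_closure)
  obtain R where R: "\<And>x. x \<in> C \<Longrightarrow> norm x \<le> R"
    using compact_imp_bounded[OF C] unfolding bounded_iff by blast
  \<comment> \<open>On the boundary U + V is at most \<tau> R^2 / 2, which is less than \<tau> (R^2
    + 1) = u x0 - v x0. So the added quadratic term cannot push a maximum to the boundary.\<close>
  define \<tau> where "\<tau> = (u x0 - v x0) / (R\<^sup>2 + 1)"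
  have pR: "R\<^sup>2 + 1 > 0" by (simp add: add_nonneg_pos)
  have \<tau>: "\<tau> > 0" using \<open>\<not> u x0 \<le> v x0\<close> pR by (simp add: \<tau>_def)
  define U where "U = (\<lambda>x. u x + \<tau> / 2 * (norm x)\<^sup>2)"
  define V where "V = (\<lambda>x. - v x)"
  have uscU: "upper_semicontinuous_on C U"
    unfolding U_def C_def
    by (intro upper_semicontinuous_on_add usc_on_imp_upper_semicontinuous_on u
        continuous_on_imp_upper_semicontinuous_on continuous_intros)
  have uscV: "upper_semicontinuous_on C V"
    unfolding V_def C_def
    by (intro usc_on_imp_upper_semicontinuous_on lsc_on_imp_usc_on_minus v)
  have x0C: "x0 \<in> C" using x0 closure_subset by (auto simp: C_def)
  obtain xm where xm: "xm \<in> C" and max: "\<And>x. x \<in> C \<Longrightarrow> U x + V x \<le> U xm + V xm"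
    using upper_semicontinuous_attains_sup[OF C _ upper_semicontinuous_on_add[OF uscU uscV]] x0C by blast
  have interior: "x \<in> \<Omega>" if x: "x \<in> C" "U xm + V xm \<le> U x + V x" for x
  proof (rule ccontr)
    assume "x \<notin> \<Omega>"
    then have "x \<in> frontier \<Omega>" using x op by (simp add: C_def frontier_def interior_open)
    then have "U x + V x \<le> \<tau> / 2 * (norm x)\<^sup>2" using bd by (simp add: U_def V_def)
    also have "\<dots> \<le> \<tau> / 2 * R\<^sup>2" using \<tau> R[OF x(1)] by (intro mult_left_mono power_mono) auto
    also have "\<dots> < \<tau> * (R\<^sup>2 + 1)" using \<tau> by (simp add: algebra_simps add_pos_nonneg)
    also have "\<dots> = u x0 - v x0" using pR by (simp add: \<tau>_def)
    also have "\<dots> \<le> U x0 + V x0" using \<tau> by (simp add: U_def V_def)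
    also have "\<dots> \<le> U xm + V xm" by (rule max[OF x0C])
    finally show False using x by simp
  qed
  \<comment> \<open>Stage \<open>n\<close> has penalty n + 1 and loss 1 / (n + 1). The Hessian error
    \<tau>/2 is only half of what was added to \<open>u\<close>.\<close>
  define good where "good = (\<lambda>n x y. x \<in> C \<and> y \<in> C \<and> (\<exists>p1 p2 L1 L2.
      U xm + V xm - 1 / real (Suc n) \<le> U x + V y - real (Suc n) / 6 * (norm (x - y))\<^sup>2
    \<and> upper_test_on C U x p1 L1 \<and> upper_test_on C V y p2 L2
    \<and> (\<forall>v. v \<bullet> L1 v + v \<bullet> L2 v \<le> \<tau> / 2 * (norm v)\<^sup>2)))"
  have "\<exists>x y. good n x y" for n
  proof -
    have pos: "real (Suc n) > 0" "\<tau> / 2 > 0" "1 / real (Suc n) > 0" using \<tau> by simp_all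
    show ?thesis
      using doubling_theorem_on_sums[OF C uscU uscV xm pos] unfolding good_def by blast
  qed
  then obtain X Y where good: "\<And>n. good n (X n) (Y n)" by metis
  have XY: "X n \<in> C" "Y n \<in> C"
      "U xm + V xm - 1 / real (Suc n) \<le> U (X n) + V (Y n) - real (Suc n) / 6 * (norm (X n - Y n))\<^sup>2" for n
    using good[of n] unfolding good_def by auto
  obtain xs \<sigma> where xs: "xs \<in> C" and \<sigma>: "strict_mono \<sigma>" and limX: "(X \<circ> \<sigma>) \<longlonglongrightarrow> xs"
    using C XY(1) unfolding compact_def by blast
  obtain a where a: "\<forall>x\<in>C. U x \<le> U a" using upper_semicontinuous_attains_sup[OF C _ uscU] x0C by blast
  obtain b where b: "\<forall>x\<in>C. V x \<le> V b" using upper_semicontinuous_attains_sup[OF C _ uscV] x0C by blast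
  \<comment> \<open>\<open>U\<close> and \<open>V\<close> are bounded above on \<open>C\<close>, so
    the penalty term stays bounded and the two contact points merge.\<close>
  define D where "D = 6 * (U a + V b - (U xm + V xm) + 1)"
  have dXY: "(norm (X n - Y n))\<^sup>2 \<le> D / real (Suc n)" for n
  proof -
    have "real (Suc n) / 6 * (norm (X n - Y n))\<^sup>2 \<le> U (X n) + V (Y n) - (U xm + V xm) + 1 / real (Suc n)"
      using XY(3)[of n] by linarith
    also have "\<dots> \<le> D / 6"
    proof -
      have "U (X n) \<le> U a" "V (Y n) \<le> V b" "1 / real (Suc n) \<le> 1" using a b XY(1,2) by auto
      then have "U (X n) + V (Y n) - (U xm + V xm) + 1 / real (Suc n) \<le> U a + V b - (U xm + V xm) + 1"
        by (intro add_mono diff_right_mono)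
      then show ?thesis by (simp add: D_def)
    qed
    finally show ?thesis by (simp add: field_simps)
  qed
  have "(\<lambda>n. D / real (Suc n)) \<longlonglongrightarrow> 0"
    using tendsto_mult_right_zero[OF LIMSEQ_inverse_real_of_nat, of D] by (simp add: divide_inverse)
  then have "(\<lambda>n. (norm (X n - Y n))\<^sup>2) \<longlonglongrightarrow> 0"
    by (rule tendsto_sandwich[OF _ _ tendsto_const, rotated 2]) (use dXY in auto)
  then have "(\<lambda>n. X n - Y n) \<longlonglongrightarrow> 0"
    using tendsto_real_sqrt[of "\<lambda>n. (norm (X n - Y n))\<^sup>2" 0] by (simp add: tendsto_norm_zero_iff)
  then have "((\<lambda>n. X n - Y n) \<circ> \<sigma>) \<longlonglongrightarrow> 0" by (rule LIMSEQ_subseq_LIMSEQ[OF _ \<sigma>])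
  from tendsto_diff[OF limX this] have limY: "(Y \<circ> \<sigma>) \<longlonglongrightarrow> xs" by (simp add: comp_def)
  have usc_lim: "\<forall>\<^sub>F n in sequentially. F (Z n) < e"
    if "upper_semicontinuous_on C F" "\<And>n. Z n \<in> C" "Z \<longlonglongrightarrow> xs" "F xs < e" for F Z and e :: real
  proof -
    have "\<forall>\<^sub>F y in at xs within C. F y < e"
      using that xs unfolding upper_semicontinuous_on_def by blast
    then obtain N where N: "open N" "xs \<in> N" "\<And>y. y \<in> N \<Longrightarrow> y \<noteq> xs \<Longrightarrow> y \<in> C \<Longrightarrow> F y < e"
      unfolding eventually_at_topological by blast
    have "\<forall>\<^sub>F n in sequentially. Z n \<in> N" using topological_tendstoD[OF that(3)] N by blast
    then show ?thesis by eventually_elim (use N(3) that(2,4) in metis)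
  qed
  \<comment> \<open>Upper semicontinuity passes near-maximality to the common limit, so
    \<open>xs\<close> maximises U + V and lies in \<open>\<Omega>\<close> by
    \<open>interior\<close>.\<close>
  have "U xm + V xm \<le> U xs + V xs"
  proof (rule ccontr)
    assume neg: "\<not> ?thesis"
    define e where "e = (U xm + V xm - (U xs + V xs)) / 3"
    have e: "e > 0" using neg by (simp add: e_def)
    have "\<forall>\<^sub>F n in sequentially. U ((X \<circ> \<sigma>) n) < U xs + e"
      using e by (intro usc_lim[OF uscU _ limX]) (auto simp: XY)
    moreover have "\<forall>\<^sub>F n in sequentially. V ((Y \<circ> \<sigma>) n) < V xs + e"
      using e by (intro usc_lim[OF uscV _ limY]) (auto simp: XY)
    moreover have "\<forall>\<^sub>F n in sequentially. 1 / real (Suc (\<sigma> n)) < e"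
    proof -
      have "((\<lambda>n. 1 / real (Suc n)) \<circ> \<sigma>) \<longlonglongrightarrow> 0"
        using LIMSEQ_inverse_real_of_nat by (intro LIMSEQ_subseq_LIMSEQ[OF _ \<sigma>]) (simp add: inverse_eq_divide)
      from order_tendstoD(2)[OF this e] show ?thesis by simp
    qed
    ultimately have "\<forall>\<^sub>F n in sequentially. False"
    proof eventually_elim
      case (elim n)
      define i where "i = 1 / real (Suc (\<sigma> n))"
      define Q where "Q = real (Suc (\<sigma> n)) / 6 * (norm (X (\<sigma> n) - Y (\<sigma> n)))\<^sup>2"
      have "Q \<ge> 0" by (simp add: Q_def)
      moreover have "i < e" using elim(3) by (simp only: i_def)
      moreover have "U xm + V xm - i \<le> U (X (\<sigma> n)) + V (Y (\<sigma> n)) - Q"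
        using XY(3)[of "\<sigma> n"] by (simp only: i_def Q_def)
      ultimately have "U xm + V xm < U xs + V xs + 3 * e"
        using elim(1,2) unfolding comp_def by linarith
      also have "3 * e = (U xm + V xm) - (U xs + V xs)" by (simp add: e_def)
      finally show False by simp
    qed
    then show False by simp
  qed
  then have xs\<Omega>: "xs \<in> \<Omega>" by (rule interior[OF xs])
  obtain c where c: "c > 0"
    and step: "\<And>A. A \<in> (SymM :: (real^'n^'n) set) \<Longrightarrow> h xs - c \<le> Gop A \<Longrightarrow> h xs + c \<le> Gop (A + (\<tau> / 2) *\<^sub>R mat 1)"
    using gain[OF xs\<Omega>, of "\<tau> / 2"] \<tau> by auto
  have cont: "isCont h xs" using hc op xs\<Omega> by (simp add: continuous_on_eq_continuous_at)
  have "\<forall>\<^sub>F n in sequentially. h xs - c < h (X (\<sigma> n))" "\<forall>\<^sub>F n in sequentially. h (Y (\<sigma> n)) < h xs + c"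
    using order_tendstoD(1)[OF isCont_tendsto_compose[OF cont limX], of "h xs - c"]
      order_tendstoD(2)[OF isCont_tendsto_compose[OF cont limY], of "h xs + c"] c by simp_all
  moreover have "\<forall>\<^sub>F n in sequentially. X (\<sigma> n) \<in> \<Omega>" "\<forall>\<^sub>F n in sequentially. Y (\<sigma> n) \<in> \<Omega>"
    using topological_tendstoD[OF limX op xs\<Omega>] topological_tendstoD[OF limY op xs\<Omega>] by simp_all
  ultimately have "\<forall>\<^sub>F n in sequentially. h xs - c < h (X (\<sigma> n)) \<and> h (Y (\<sigma> n)) < h xs + c
      \<and> X (\<sigma> n) \<in> \<Omega> \<and> Y (\<sigma> n) \<in> \<Omega>"
    by eventually_elim simp
  then obtain n where hX: "h xs - c < h (X (\<sigma> n))" and hY: "h (Y (\<sigma> n)) < h xs + c"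
      and X\<Omega>: "X (\<sigma> n) \<in> \<Omega>" and Y\<Omega>: "Y (\<sigma> n) \<in> \<Omega>"
    unfolding eventually_sequentially by blast
  define x where "x = X (\<sigma> n)"
  define y where "y = Y (\<sigma> n)"
  obtain p1 p2 L1 L2 where t1: "upper_test_on C U x p1 L1" and t2: "upper_test_on C V y p2 L2"
    and L: "\<And>v. v \<bullet> L1 v + v \<bullet> L2 v \<le> \<tau> / 2 * (norm v)\<^sup>2"
    using good[of "\<sigma> n"] unfolding good_def x_def y_def by blast
  obtain r1 where r1: "r1 > 0" and L1: "linear L1"
    and le1: "\<And>w. norm w < r1 \<Longrightarrow> x + w \<in> C \<Longrightarrow> U (x + w) \<le> U x + p1 \<bullet> w + (w \<bullet> L1 w) / 2"
    using t1 unfolding upper_test_on_def by auto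
  obtain r2 where r2: "r2 > 0" and L2: "linear L2"
    and le2: "\<And>w. norm w < r2 \<Longrightarrow> y + w \<in> C \<Longrightarrow> V (y + w) \<le> V y + p2 \<bullet> w + (w \<bullet> L2 w) / 2"
    using t2 unfolding upper_test_on_def by auto
  obtain A1 where A1: "A1 \<in> SymM" "\<And>v. v \<bullet> (A1 *v v) = v \<bullet> L1 v"
    using symmetric_matrix_of_quadratic_form[OF L1] by blast
  obtain A2 where A2: "A2 \<in> SymM" "\<And>v. v \<bullet> (A2 *v v) = v \<bullet> L2 v"
    using symmetric_matrix_of_quadratic_form[OF L2] by blast
  \<comment> \<open>\<open>A\<close> removes the Hessian of the quadratic term added to
    \<open>u\<close>; \<open>B\<close> turns the test of \<open>- v\<close> from above into a test
    of \<open>v\<close> from below.\<close>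
  define A where "A = A1 + (- \<tau>) *\<^sub>R mat 1"
  define B where "B = - A2"
  have qA: "w \<bullet> (A *v w) = w \<bullet> L1 w - \<tau> * (norm w)\<^sup>2" for w
    unfolding A_def matrix_vector_mult_add_rdistrib mat_scale_vector inner_add_right A1(2)
    by (simp add: power2_norm_eq_inner)
  have qB: "w \<bullet> (B *v w) = - (w \<bullet> L2 w)" for w
    unfolding A2(2)[symmetric] B_def
    using matrix_vector_mult_diff_rdistrib[of 0 A2 w] by (simp add: inner_simps)
  have A: "A \<in> SymM" unfolding A_def by (rule SymM_shift[OF A1(1)])
  have B: "B \<in> SymM" using A2(1) by (simp add: SymM_def B_def transpose_def vec_eq_iff)
  have sub: "\<Omega> \<subseteq> C" by (simp add: C_def closure_subset)
  have "(u x, A) \<in> Jplus \<Omega> u x"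
  proof (rule Jplus_quadratic[OF A r1])
    fix w assume w: "norm w < r1" "x + w \<in> \<Omega>"
    have "(norm (x + w))\<^sup>2 = (norm x)\<^sup>2 + 2 * (x \<bullet> w) + (norm w)\<^sup>2"
      by (simp add: power2_norm_eq_inner inner_simps inner_commute)
    moreover have "U (x + w) \<le> U x + p1 \<bullet> w + (w \<bullet> L1 w) / 2" using le1 w sub by blast
    ultimately show "u (x + w) \<le> u x + (p1 - \<tau> *\<^sub>R x) \<bullet> w + (w \<bullet> (A *v w)) / 2"
      unfolding U_def qA by (simp add: inner_diff_left algebra_simps diff_divide_distrib add_divide_distrib)
  qed
  then have "h x \<le> Gop A" using u(2) X\<Omega> unfolding visc_sub_def x_def by blast
  then have "h xs + c \<le> Gop (A + (\<tau> / 2) *\<^sub>R mat 1)" using hX by (intro step A) (simp add: x_def)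
  \<comment> \<open>A1 + A2 \<le> (\<tau>/2) I and A = A1 - \<tau> I give A + (\<tau>/2) I \<le> -
    A2 = B. The chain ends in h xs + c \<le> h y, against the choice of \<open>n\<close>.\<close>
  also have "\<dots> \<le> Gop B"
  proof (rule Gop_mono[OF SymM_shift[OF A] B])
    show "psd_le (A + (\<tau> / 2) *\<^sub>R mat 1) B"
      unfolding psd_le_def
    proof
      fix w :: "real^'n"
      have "w \<bullet> ((B - (A + (\<tau> / 2) *\<^sub>R mat 1)) *v w) = w \<bullet> (B *v w) - (w \<bullet> (A *v w) + \<tau> / 2 * (norm w)\<^sup>2)"
        by (simp add: matrix_vector_mult_diff_rdistrib matrix_vector_mult_add_rdistrib inner_simps
            power2_norm_eq_inner)
      then show "0 \<le> w \<bullet> ((B - (A + (\<tau> / 2) *\<^sub>R mat 1)) *v w)"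
        unfolding qA qB using L[of w] by (simp add: algebra_simps)
    qed
  qed
  also have "\<dots> \<le> h y"
  proof -
    have "(v y, B) \<in> Jminus \<Omega> v y"
    proof (rule Jminus_quadratic[OF B r2])
      fix w assume w: "norm w < r2" "y + w \<in> \<Omega>"
      have "V (y + w) \<le> V y + p2 \<bullet> w + (w \<bullet> L2 w) / 2" using le2 w sub by blast
      then show "v y + (- p2) \<bullet> w + (w \<bullet> (B *v w)) / 2 \<le> v (y + w)"
        unfolding V_def qB by simp
    qed
    then show ?thesis using v(2) Y\<Omega> unfolding visc_super_def y_def by blast
  qed
  finally show False using hY by (simp add: y_def)
qed

section \<open>Ellipticity, Hausdorff continuity and boundary of the superlevel sets\<close>

lemma proper_elliptic_phase:
  fixes \<Omega> :: "(real^'n) set" and h :: "real^'n \<Rightarrow> real"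
  assumes "\<And>x. x \<in> \<Omega> \<Longrightarrow> \<bar>h x\<bar> < real CARD('n) * pi / 2"
  shows "proper_elliptic \<Omega> (\<lambda>x. {(r, A). A \<in> SymM \<and> Gop A \<ge> h x})"
  unfolding proper_elliptic_def
proof (intro ballI conjI allI impI)
  fix x assume x: "x \<in> \<Omega>"
  let ?T = "{(r::real, A :: real^'n^'n). A \<in> SymM \<and> Gop A \<ge> h x}"
  \<comment> \<open>\<open>t\<close> solves N arctan t = h x, so the multiple \<open>t\<close> of
    the identity lies in the set and the multiple t - 1 does not. The bound on \<open>h x\<close>
    puts h x / N in the range of the arctangent.\<close>
  define t where "t = tan (h x / real CARD('n))"
  have "\<bar>h x / real CARD('n)\<bar> < pi / 2" using assms[OF x] by (simp add: abs_mult divide_simps mult.commute)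
  then have "- (pi / 2) < h x / real CARD('n)" "h x / real CARD('n) < pi / 2" by linarith+
  from arctan_tan[OF this] have t: "real CARD('n) * arctan t = h x" by (simp add: t_def)
  show "?T \<subseteq> UNIV \<times> SymM" by auto
  have "closed {A \<in> SymM. Gop A \<in> {h x..}}"
    using continuous_closed_preimage[OF continuous_on_Gop closed_SymM, of "{h x..}"]
    by (simp add: vimage_def Int_def)
  then have "closed (UNIV \<times> {A \<in> SymM. Gop A \<in> {h x..}} :: (real \<times> (real^'n^'n)) set)"
    by (intro closed_Times closed_UNIV)
  moreover have "?T = UNIV \<times> {A \<in> SymM. Gop A \<in> {h x..}}" by auto
  ultimately show "closed ?T" by simp
  have "(0, t *\<^sub>R mat 1) \<in> ?T" using t by (simp add: Gop_scaled_identity scaled_identity_SymM)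
  then show "?T \<noteq> {}" by blast
  have "real CARD('n) * arctan (t - 1) < h x"
    unfolding t[symmetric] by (simp add: arctan_less_iff)
  then have "(0, (t - 1) *\<^sub>R mat 1) \<notin> ?T" by (simp only: mem_Collect_eq case_prod_conv Gop_scaled_identity not_le[symmetric] simp_thms)
  moreover have "(0, (t - 1) *\<^sub>R mat 1) \<in> UNIV \<times> SymM" using scaled_identity_SymM by blast
  ultimately show "?T \<noteq> UNIV \<times> SymM" by blast
  fix r s :: real and A P :: "real^'n^'n" assume "(r, A) \<in> ?T" "(s, P) \<in> Qset"
  then have A: "A \<in> SymM" "h x \<le> Gop A" and P: "P \<in> SymM" "psd_le 0 P" by (auto simp: Qset_def)
  have AP: "A + P \<in> SymM" using A(1) P(1) by (simp add: SymM_def transpose_def vec_eq_iff)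
  have "psd_le A (A + P)" using P(2) by (simp add: psd_le_def)
  from Gop_mono[OF A(1) AP this] show "(r + s, A + P) \<in> ?T" using A AP by simp
qed

text \<open>By \<open>gain\<close>, adding e I to a matrix takes it from either of the sets at
  \<open>x\<close> and \<open>y\<close> into the other, since \<open>h y\<close> stays within
  \<open>c\<close> of \<open>h x\<close>. The shift has norm exactly \<open>e\<close>, and e =
  \<eta>/2 makes the distance strictly less than \<eta>.\<close>

lemma hausdorff_continuous_phase:
  fixes \<Omega> :: "(real^'n) set" and h :: "real^'n \<Rightarrow> real"
  assumes hc: "continuous_on \<Omega> h"
    and gain: "\<And>x \<eta>. x \<in> \<Omega> \<Longrightarrow> \<eta> > 0 \<Longrightarrow>
      \<exists>c>0. \<forall>A\<in>(SymM :: (real^'n^'n) set). h x - c \<le> Gop A \<longrightarrow> h x + c \<le> Gop (A + \<eta> *\<^sub>R mat 1)"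
  shows "hausdorff_continuous \<Omega> (\<lambda>x. {(r, A). A \<in> SymM \<and> Gop A \<ge> h x})"
  unfolding hausdorff_continuous_def
proof (intro ballI allI impI)
  fix x :: "real^'n" and \<eta> :: real assume x: "x \<in> \<Omega>" and \<eta>: "\<eta> > 0"
  let ?T = "\<lambda>x. {(r::real, A :: real^'n^'n). A \<in> SymM \<and> Gop A \<ge> h x}"
  define e where "e = \<eta> / 2"
  have e: "e > 0" "e < \<eta>" using \<eta> by (auto simp: e_def)
  obtain c where c: "c > 0"
    and step: "\<And>A. A \<in> (SymM :: (real^'n^'n) set) \<Longrightarrow> h x - c \<le> Gop A \<Longrightarrow> h x + c \<le> Gop (A + e *\<^sub>R mat 1)"
    using gain[OF x e(1)] by blast
  obtain \<delta> where \<delta>: "\<delta> > 0" and near: "\<And>y. y \<in> \<Omega> \<Longrightarrow> dist y x < \<delta> \<Longrightarrow> dist (h y) (h x) < c"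
    using hc x c unfolding continuous_on_iff by blast
  show "\<exists>\<delta>>0. \<forall>y\<in>\<Omega>. dist x y < \<delta> \<longrightarrow> hdist (?T x) (?T y) < ereal \<eta>"
  proof (intro exI[of _ \<delta>] conjI \<delta> ballI impI)
    fix y assume "y \<in> \<Omega>" "dist x y < \<delta>"
    then have hy: "\<bar>h y - h x\<bar> < c" using near by (simp add: dist_commute dist_real_def)
    have shift: "(r, A + e *\<^sub>R mat 1) \<in> ?T z'" if "(r, A) \<in> ?T z" "z = x \<or> z = y" "z' = x \<or> z' = y" for r A z z'
    proof -
      have A: "A \<in> SymM" "h x - c \<le> Gop A" using that hy c by auto
      from step[OF A] have "h z' \<le> Gop (A + e *\<^sub>R mat 1)" using that(3) hy c by auto
      then show ?thesis using SymM_shift[OF A(1)] by simp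
    qed
    have d1: "pnorm ((r, A) - (r, A + e *\<^sub>R mat 1)) = e" "pnorm ((r, A + e *\<^sub>R mat 1) - (r, A)) = e"
      for r and A :: "real^'n^'n"
      using pnorm_scaled_identity[where 'n='n, of "- e"] pnorm_scaled_identity[where 'n='n, of e] e by simp_all
    have "(SUP a\<in>?T x. INF b\<in>?T y. ereal (pnorm (a - b))) \<le> ereal e"
    proof (rule SUP_least)
      fix a assume a: "a \<in> ?T x"
      obtain r A where rA: "a = (r, A)" by (metis surj_pair)
      show "(INF b\<in>?T y. ereal (pnorm (a - b))) \<le> ereal e"
        using shift[of r A x y] a rA d1(1)[of r A] by (intro INF_lower2[of "(r, A + e *\<^sub>R mat 1)"]) simp_all
    qed
    moreover have "(SUP b\<in>?T y. INF a\<in>?T x. ereal (pnorm (a - b))) \<le> ereal e"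
    proof (rule SUP_least)
      fix b assume b: "b \<in> ?T y"
      obtain r A where rA: "b = (r, A)" by (metis surj_pair)
      show "(INF a\<in>?T x. ereal (pnorm (a - b))) \<le> ereal e"
        using shift[of r A y x] b rA d1(2)[of r A] by (intro INF_lower2[of "(r, A + e *\<^sub>R mat 1)"]) simp_all
    qed
    ultimately have "hdist (?T x) (?T y) \<le> ereal e" unfolding hdist_def by simp
    also have "\<dots> < ereal \<eta>" using e by simp
    finally show "hdist (?T x) (?T y) < ereal \<eta>" .
  qed
qed

text \<open>The boundary is taken in the space of pairs with symmetric matrix part. By continuity of
  \<open>Gop\<close> there, the closure of the set lies in Gop \<ge> t and that of its complement in
  Gop \<le> t.\<close>

lemma frontier_of_phase_superlevel:
  "(top_of_set (UNIV \<times> SymM)) frontier_of {(r::real, A :: real^'n^'n). A \<in> SymM \<and> Gop A \<ge> t}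
    \<subseteq> {(r, A). Gop A = t}"
proof -
  let ?X = "top_of_set (UNIV \<times> SymM) :: (real \<times> (real^'n^'n)) topology"
  let ?T = "{(r::real, A :: real^'n^'n). A \<in> SymM \<and> Gop A \<ge> t}"
  have cont: "continuous_on (UNIV \<times> SymM) (\<lambda>z :: real \<times> (real^'n^'n). Gop (snd z))"
    by (rule continuous_on_compose2[OF continuous_on_Gop]) (auto intro: continuous_intros)
  have c1: "closedin ?X ((UNIV \<times> SymM) \<inter> (\<lambda>z. Gop (snd z)) -` {t..})"
    by (intro continuous_closedin_preimage cont) simp
  have c2: "closedin ?X ((UNIV \<times> SymM) \<inter> (\<lambda>z. Gop (snd z)) -` {..t})"
    by (intro continuous_closedin_preimage cont) simp
  have "?X closure_of ?T \<subseteq> (UNIV \<times> SymM) \<inter> (\<lambda>z. Gop (snd z)) -` {t..}"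
    by (intro closure_of_minimal c1) auto
  moreover have "?X closure_of (topspace ?X - ?T) \<subseteq> (UNIV \<times> SymM) \<inter> (\<lambda>z. Gop (snd z)) -` {..t}"
    by (intro closure_of_minimal c2) auto
  ultimately show ?thesis
    unfolding frontier_of_closures by fastforce
qed

theorem theorem6p18:
  fixes \<Omega> :: "(real^'n) set" and h :: "real^'n \<Rightarrow> real" and k :: nat
    and \<Theta> :: "real^'n \<Rightarrow> (real \<times> (real^'n^'n)) set"
  assumes "bounded \<Omega>" and "open \<Omega>" and "connected \<Omega>"
    and "continuous_on \<Omega> h"
    and "1 \<le> k" and "k \<le> CARD('n)"
    and "\<forall>x\<in>\<Omega>. h x \<in> {(real CARD('n) - 2 * real k) * pi / 2 <..< (real CARD('n) - 2 * (real k - 1)) * pi / 2}"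
    and "\<And>x. \<Theta> x = {(r, A). A \<in> SymM \<and> Gop A \<ge> h x}"
  shows "proper_elliptic \<Omega> \<Theta> \<and> hausdorff_continuous \<Omega> \<Theta>
    \<and> (\<forall>x\<in>\<Omega>. (top_of_set (UNIV \<times> SymM)) frontier_of (\<Theta> x) \<subseteq> {(r, A). Gop A = h x})
    \<and> (\<forall>u v. usc_on (closure \<Omega>) u \<longrightarrow> lsc_on (closure \<Omega>) v
           \<longrightarrow> visc_sub \<Omega> h u \<longrightarrow> visc_super \<Omega> h v
           \<longrightarrow> (\<forall>x\<in>frontier \<Omega>. u x \<le> v x) \<longrightarrow> (\<forall>x\<in>\<Omega>. u x \<le> v x))"
proof -
  have \<Theta>: "\<Theta> = (\<lambda>x. {(r, A). A \<in> SymM \<and> Gop A \<ge> h x})" using assms(8) by blast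
  have gain: "\<exists>c>0. \<forall>A\<in>(SymM :: (real^'n^'n) set). h x - c \<le> Gop A \<longrightarrow> h x + c \<le> Gop (A + \<eta> *\<^sub>R mat 1)"
    if "x \<in> \<Omega>" "\<eta> > 0" for x \<eta>
    using assms(7) that by (intro Gop_uniform_gain[of k]) auto
  \<comment> \<open>Because k lies between 1 and N, the interval stays inside (-N pi/2, N pi/2), as
    the construction of scalar matrices in \<open>proper_elliptic_phase\<close> requires.\<close>
  have "\<bar>h x\<bar> < real CARD('n) * pi / 2" if "x \<in> \<Omega>" for x
  proof -
    have "- real CARD('n) * (pi / 2) \<le> (real CARD('n) - 2 * real k) * (pi / 2)"
      "(real CARD('n) - 2 * (real k - 1)) * (pi / 2) \<le> real CARD('n) * (pi / 2)"
      using assms(5,6) by (intro mult_right_mono; simp)+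
    moreover have "(real CARD('n) - 2 * real k) * pi / 2 < h x"
      "h x < (real CARD('n) - 2 * (real k - 1)) * pi / 2" using assms(7) that by auto
    ultimately show ?thesis by linarith
  qed
  then have "proper_elliptic \<Omega> \<Theta>" unfolding \<Theta> by (rule proper_elliptic_phase)
  moreover have "hausdorff_continuous \<Omega> \<Theta>"
    unfolding \<Theta> by (rule hausdorff_continuous_phase[OF assms(4) gain])
  moreover have "u x \<le> v x" if "usc_on (closure \<Omega>) u" "lsc_on (closure \<Omega>) v" "visc_sub \<Omega> h u"
    "visc_super \<Omega> h v" "\<forall>x\<in>frontier \<Omega>. u x \<le> v x" "x \<in> \<Omega>" for u v x
    using viscosity_comparison[OF assms(1,2,4) gain that(1,3,2,4,5,6)] .
  ultimately show ?thesis
    using frontier_of_phase_superlevel unfolding \<Theta> by blast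
qed

end
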